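(* For every integer $n>5$ the following inequalities hold: $$|\operatorname{Av}_n(\underline{12}\square 3)|>|\operatorname{Av}_n(\underline{13}\square 2)|,\qquad |\operatorname{Av}_n(1\square 2\square 3)|>|\operatorname{Av}_n(1\square 3\square 2)|,\qquad |\operatorname{Av}_n(\underline{123})|>|\operatorname{Av}_n(\underline{132})|,$$ whereas $$|\operatorname{Av}_n(1\square\underline{23})|<|\operatorname{Av}_n(1\square\underline{32})|.$$
   Context: For a pattern $q$, $\operatorname{Av}_n(q)$ is the set of permutations $\pi=\pi_1\cdots\pi_n$ of $[n]$ with no occurrence of $q$. For letters $abc\in S_3$, an occurrence is a triple of positions $i<j<k$ such that $\pi_i\pi_j\pi_k$ is in the same relative order as $abc$, subject to the following position constraints: for $\underline{ab}\square c$: $j=i+1$ and $k\ge j+2$; for $a\square\underline{bc}$: $j\ge i+2$ and $k=j+1$; for $a\square b\square c$: $j\ge i+2$ and $k\ge j+2$; for $\underline{abc}$: $j=i+1$ and $k=j+1$. *)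

theory Defs
  imports "HOL-Combinatorics.Multiset_Permutations"
begin

text \<open>
  A permutation of \<open>{1..n}\<close> is represented by its one-line word, i.e. an element of
  \<open>permutations_of_set {1..n}\<close>. Positions in a word are counted from 0; this is harmless
  because only differences of positions matter.
\<close>

definition order_isomorphic :: "nat list \<Rightarrow> nat list \<Rightarrow> bool" where
  "order_isomorphic u v \<longleftrightarrow>
     length u = length v \<and>
     (\<forall>r < length u. \<forall>s < length u. u ! r < u ! s \<longleftrightarrow> v ! r < v ! s)"

text \<open>
  The requirement on the positions of two consecutive letters of a pattern: \<open>Adjacent\<close> is an
  underline joining the two letters, \<open>Separated\<close> is a box between them.
\<close>

datatype gap = Adjacent | Separated

fun gap_holds :: "gap \<Rightarrow> nat \<Rightarrow> nat \<Rightarrow> bool" where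
  "gap_holds Adjacent i j \<longleftrightarrow> j = i + 1"
| "gap_holds Separated i j \<longleftrightarrow> j \<ge> i + 2"

text \<open>
  A pattern of length three is given by its word \<open>q\<close> and its two gaps \<open>g\<close>, \<open>h\<close>.
  Either kind of gap forces \<open>i < j < k\<close>.
\<close>

definition occurrence ::
  "nat list \<Rightarrow> gap \<Rightarrow> gap \<Rightarrow> nat list \<Rightarrow> nat \<Rightarrow> nat \<Rightarrow> nat \<Rightarrow> bool" where
  "occurrence q g h p i j k \<longleftrightarrow>
     k < length p \<and> gap_holds g i j \<and> gap_holds h j k \<and>
     order_isomorphic [p ! i, p ! j, p ! k] q"

definition Av :: "nat \<Rightarrow> nat list \<Rightarrow> gap \<Rightarrow> gap \<Rightarrow> nat list set" where
  "Av n q g h =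
     {p \<in> permutations_of_set {1..n}. \<not> (\<exists>i j k. occurrence q g h p i j k)}"

end

theory Submission
  imports Defs Complex_Main
begin

text \<open>
  Each inequality comes from a decomposition that both pattern classes share.

  For consecutive patterns and for patterns ending in an adjacent pair, write a permutation as
  \<open>\<sigma> m \<tau>\<close> with \<open>m\<close> its minimum. The number of avoiders is then a sum over the set \<open>S\<close> of letters
  of \<open>\<sigma>\<close>, the number of admissible \<open>\<tau>\<close> depends on \<open>S\<close> only, and the summands compare term by term
  by induction on the set of letters. After reversal and complementation, the patterns beginning with
  an adjacent pair become \<open>1\<box>23\<close> and \<open>2\<box>13\<close>, the last two letters being adjacent. The avoiders
  of the former obey a superexponential recurrence of Bell type, while the same decomposition
  bounds those of the latter by a sequence with an algebraic generating function, at most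
  \<open>3/2 \<cdot> 5^n\<close>; this settles all \<open>n \<ge> 24\<close>, and the remaining values are computed.

  Avoiders of the fully separated patterns are built from left to right. The number of completions
  depends only on how many unused letters lie in three ranges, and the recurrences for the two
  patterns differ in a single term.
\<close>

text \<open>The cut is made at the minimum \<open>m\<close> because \<open>m\<close> can only play
  the letter 1 of a pattern, so its presence restricts mostly the letters behind it. As
  \<open>S\<close> is an arbitrary subset, all counts are taken over arbitrary finite sets of
  letters. The patterns beginning with an adjacent pair resist a termwise comparison: for 2\<box>13,
  whether \<open>\<tau>\<close> may follow \<open>\<sigma>\<close> depends on which letter of
  \<open>\<sigma>\<close> comes last, not only on \<open>S\<close>. The growth rates decide instead.
  With \<open>m\<close> as the 1 of 2\<box>13, every letter in front of \<open>m\<close>, except the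
  one next to it, must exceed everything behind \<open>m\<close>. So \<open>S\<close> is nearly a
  top segment, and convolutions replace the sums with binomial coefficients that an arbitrary
  \<open>S\<close> produces for 1\<box>23. Strictness in the other three comparisons comes each time
  from one explicit summand, or a short chain of them; the number of letters it takes is the
  threshold 4, 5 or 6 of the respective lemma.\<close>

lemma all_nat_split: "(\<forall>i. P i) \<longleftrightarrow> P 0 \<and> (\<forall>i. P (Suc i))"
  by (metis not0_implies_Suc)

text \<open>Stated for any set \<open>A\<close> of letters, since cutting at the minimum or removing
  a letter leaves sets that are not intervals.\<close>

definition arrangements :: "(nat list \<Rightarrow> bool) \<Rightarrow> nat set \<Rightarrow> nat list set" where
  "arrangements P A = {p \<in> permutations_of_set A. P p}"

definition num_arr :: "(nat list \<Rightarrow> bool) \<Rightarrow> nat set \<Rightarrow> nat" where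
  "num_arr P A = card (arrangements P A)"

lemma in_arrangements: "p \<in> arrangements P A \<longleftrightarrow> set p = A \<and> distinct p \<and> P p"
  by (auto simp: arrangements_def permutations_of_set_def)

lemma finite_arrangements [simp]: "finite A \<Longrightarrow> finite (arrangements P A)"
  by (simp add: arrangements_def)

lemma arrangements_empty: "arrangements P {} = (if P [] then {[]} else {})"
  by (auto simp: arrangements_def)

lemma arrangements_singleton: "arrangements P {x} = (if P [x] then {[x]} else {})"
  by (auto simp: arrangements_def)

lemma num_arr_empty: "num_arr P {} = (if P [] then 1 else 0)"
  by (simp add: num_arr_def arrangements_empty)

lemma num_arr_singleton: "num_arr P {x} = (if P [x] then 1 else 0)"
  by (simp add: num_arr_def arrangements_singleton)

text \<open>Inserting \<open>m\<close> between \<open>\<sigma>\<close> and \<open>\<tau>\<close> is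
  injective because \<open>m\<close> occurs only once. Since \<open>T\<close> sees only
  \<open>set \<sigma>\<close>, the choices of \<open>\<sigma>\<close> and \<open>\<tau>\<close> are
  independent once \<open>S\<close> is fixed, which gives the product.\<close>

lemma num_arr_split_min:
  assumes A: "finite A" "A \<noteq> {}"
    and P: "\<And>\<sigma> \<tau>. \<lbrakk>distinct \<sigma>; distinct \<tau>; set \<sigma> \<inter> set \<tau> = {}; set \<sigma> \<union> set \<tau> = A - {Min A}\<rbrakk>
      \<Longrightarrow> P (\<sigma> @ Min A # \<tau>) \<longleftrightarrow> Q \<sigma> \<and> T (set \<sigma>) \<tau>"
  shows "num_arr P A = (\<Sum>S\<in>Pow (A - {Min A}). num_arr Q S * num_arr (T S) (A - {Min A} - S))"
proof -
  define m where "m = Min A"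
  have m: "m \<in> A" using A by (simp add: m_def)
  let ?X = "\<lambda>S. arrangements Q S \<times> arrangements (T S) (A - {m} - S)"
  have bij: "bij_betw (\<lambda>(S, \<sigma>, \<tau>). \<sigma> @ m # \<tau>) (Sigma (Pow (A - {m})) ?X) (arrangements P A)"
  proof (rule bij_betw_imageI)
    show "inj_on (\<lambda>(S, \<sigma>, \<tau>). \<sigma> @ m # \<tau>) (Sigma (Pow (A - {m})) ?X)"
    proof (rule inj_onI)
      fix u v
      assume u: "u \<in> Sigma (Pow (A - {m})) ?X" and v: "v \<in> Sigma (Pow (A - {m})) ?X"
        and eq: "(\<lambda>(S, \<sigma>, \<tau>). \<sigma> @ m # \<tau>) u = (\<lambda>(S, \<sigma>, \<tau>). \<sigma> @ m # \<tau>) v"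
      obtain \<sigma> \<tau> where u': "u = (set \<sigma>, \<sigma>, \<tau>)" "m \<notin> set \<sigma>" "m \<notin> set \<tau>"
        using u by (cases u) (auto simp: in_arrangements)
      obtain \<sigma>' \<tau>' where v': "v = (set \<sigma>', \<sigma>', \<tau>')" "m \<notin> set \<sigma>'" "m \<notin> set \<tau>'"
        using v by (cases v) (auto simp: in_arrangements)
      have "\<sigma> @ m # \<tau> = \<sigma>' @ m # \<tau>'" using eq u' v' by simp
      then have "\<sigma> = \<sigma>' \<and> \<tau> = \<tau>'"
        using u' v' by (metis append_Cons_eq_iff)
      then show "u = v" using u' v' by simp
    qed
    show "(\<lambda>(S, \<sigma>, \<tau>). \<sigma> @ m # \<tau>) ` Sigma (Pow (A - {m})) ?X = arrangements P A"
    proof (intro equalityI subsetI)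
      fix p assume "p \<in> (\<lambda>(S, \<sigma>, \<tau>). \<sigma> @ m # \<tau>) ` Sigma (Pow (A - {m})) ?X"
      then obtain \<sigma> \<tau> where "p = \<sigma> @ m # \<tau>" "set \<sigma> \<subseteq> A - {m}" "distinct \<sigma>" "Q \<sigma>"
        "set \<tau> = A - {m} - set \<sigma>" "distinct \<tau>" "T (set \<sigma>) \<tau>"
        by (auto simp: in_arrangements)
      moreover from this have "P p"
        using P[of \<sigma> \<tau>] by (auto simp: m_def)
      ultimately show "p \<in> arrangements P A"
        using m by (auto simp: in_arrangements)
    next
      fix p assume p: "p \<in> arrangements P A"
      then have "m \<in> set p" using m by (simp add: in_arrangements)
      then obtain \<sigma> \<tau> where s: "p = \<sigma> @ m # \<tau>" by (meson split_list)
      with p have d: "distinct \<sigma>" "distinct \<tau>" "set \<sigma> \<inter> set \<tau> = {}" "set \<sigma> \<union> set \<tau> = A - {m}" and "P (\<sigma> @ m # \<tau>)"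
        by (auto simp: in_arrangements)
      then have "Q \<sigma> \<and> T (set \<sigma>) \<tau>" using P[of \<sigma> \<tau>] by (simp add: m_def)
      then have "(set \<sigma>, \<sigma>, \<tau>) \<in> Sigma (Pow (A - {m})) ?X"
        using d by (auto simp: in_arrangements)
      then show "p \<in> (\<lambda>(S, \<sigma>, \<tau>). \<sigma> @ m # \<tau>) ` Sigma (Pow (A - {m})) ?X"
        using s by (intro image_eqI[where x = "(set \<sigma>, \<sigma>, \<tau>)"]) (simp_all del: mem_Sigma_iff)
    qed
  qed
  have "num_arr P A = card (Sigma (Pow (A - {m})) ?X)"
    using bij_betw_same_card[OF bij] by (simp add: num_arr_def)
  also have "\<dots> = (\<Sum>S\<in>Pow (A - {m}). card (?X S))"
  proof (rule card_SigmaI)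
    show "\<forall>S\<in>Pow (A - {m}). finite (?X S)"
      using A finite_subset by (intro ballI finite_cartesian_product finite_arrangements) auto
  qed (use A in simp)
  finally show ?thesis
    by (simp only: num_arr_def card_cartesian_product m_def)
qed

text \<open>Deleting the last letter \<open>x\<close> is injective once \<open>x\<close> is known,
  and \<open>P\<close> survives it.\<close>

lemma num_arr_le_delete_last:
  assumes A: "finite A" "A \<noteq> {}" and P: "\<And>p x. P (p @ [x]) \<Longrightarrow> P p"
  shows "num_arr P A \<le> (\<Sum>x\<in>A. num_arr P (A - {x}))"
proof -
  have "arrangements P A \<subseteq> (\<Union>x\<in>A. (\<lambda>p. p @ [x]) ` arrangements P (A - {x}))"
  proof
    fix p assume p: "p \<in> arrangements P A"
    with A have "p \<noteq> []" by (auto simp: in_arrangements)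
    then obtain q x where "p = q @ [x]" by (cases p rule: rev_cases) auto
    with p P[of q x] show "p \<in> (\<Union>x\<in>A. (\<lambda>p. p @ [x]) ` arrangements P (A - {x}))"
      by (auto simp: in_arrangements)
  qed
  then have "num_arr P A \<le> card (\<Union>x\<in>A. (\<lambda>p. p @ [x]) ` arrangements P (A - {x}))"
    unfolding num_arr_def using A by (intro card_mono) auto
  also have "\<dots> \<le> (\<Sum>x\<in>A. card ((\<lambda>p. p @ [x]) ` arrangements P (A - {x})))"
    by (rule card_UN_le) (use A in simp)
  also have "\<dots> \<le> (\<Sum>x\<in>A. num_arr P (A - {x}))"
    unfolding num_arr_def using A by (intro sum_mono card_image_le) auto
  finally show ?thesis .
qed

lemma num_arr_pos:
  assumes "finite A" "set p = A" "distinct p" "P p"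
  shows "num_arr P A > 0"
  using assms by (auto simp: num_arr_def card_gt_0_iff in_arrangements)

text \<open>The number of larger elements takes each value below \<open>card B\<close> exactly once.
  This turns sums over letters into sums over ranks.\<close>

lemma sum_card_greater:
  fixes f :: "nat \<Rightarrow> nat" and B :: "nat set"
  assumes "finite B"
  shows "(\<Sum>x\<in>B. f (card {z\<in>B. x < z})) = (\<Sum>j<card B. f j)"
  using assms
proof (induction B rule: finite_linorder_min_induct)
  case (insert b B)
  have "{z \<in> insert b B. b < z} = B" "b \<notin> B" using insert.hyps by auto
  moreover have "{z \<in> insert b B. x < z} = {z\<in>B. x < z}" if "x \<in> B" for x
    using that insert.hyps by auto
  ultimately show ?case using insert by simp
qed simp

lemma sum_card_less:
  fixes f :: "nat \<Rightarrow> nat" and B :: "nat set"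
  assumes "finite B"
  shows "(\<Sum>x\<in>B. f (card {z\<in>B. z < x})) = (\<Sum>j<card B. f j)"
  using assms
proof (induction B rule: finite_linorder_max_induct)
  case (insert b B)
  have "{z \<in> insert b B. z < b} = B" "b \<notin> B" using insert.hyps by auto
  moreover have "{z \<in> insert b B. z < x} = {z\<in>B. z < x}" if "x \<in> B" for x
    using that insert.hyps by auto
  ultimately show ?case using insert by simp
qed simp

section \<open>Order relations of the patterns\<close>

definition rel123 :: "nat \<Rightarrow> nat \<Rightarrow> nat \<Rightarrow> bool" where
  "rel123 a b c \<longleftrightarrow> a < b \<and> b < c"

definition rel132 :: "nat \<Rightarrow> nat \<Rightarrow> nat \<Rightarrow> bool" where
  "rel132 a b c \<longleftrightarrow> a < c \<and> c < b"

definition rel213 :: "nat \<Rightarrow> nat \<Rightarrow> nat \<Rightarrow> bool" where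
  "rel213 a b c \<longleftrightarrow> b < a \<and> a < c"

lemmas rel_defs = rel123_def rel132_def rel213_def

lemma order_isomorphic_123: "order_isomorphic [a, b, c] [1, 2, 3] \<longleftrightarrow> rel123 a b c"
  by (simp add: order_isomorphic_def rel_defs All_less_Suc) linarith

lemma order_isomorphic_132: "order_isomorphic [a, b, c] [1, 3, 2] \<longleftrightarrow> rel132 a b c"
  by (simp add: order_isomorphic_def rel_defs All_less_Suc) linarith

lemma Av_eq_arrangements:
  assumes "\<And>p. P p \<longleftrightarrow> \<not> (\<exists>i j k. occurrence q g h p i j k)"
  shows "Av n q g h = arrangements P {1..n}"
  using assms by (auto simp: Av_def arrangements_def)

lemma Min_less:
  fixes A :: "nat set"
  shows "\<lbrakk>finite A; x \<in> A; x \<noteq> Min A\<rbrakk> \<Longrightarrow> Min A < x"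
  using Min_le[of A x] by linarith

lemma Min_less_split:
  fixes A :: "nat set"
  assumes "finite A" "set \<sigma> \<union> set \<tau> = A - {Min A}"
  shows "\<forall>x\<in>set \<sigma> \<union> set \<tau>. Min A < x"
  using assms Min_less by blast

section \<open>Consecutive patterns\<close>

fun avoids_consec :: "(nat \<Rightarrow> nat \<Rightarrow> nat \<Rightarrow> bool) \<Rightarrow> nat list \<Rightarrow> bool" where
  "avoids_consec R (a # b # c # xs) \<longleftrightarrow> \<not> R a b c \<and> avoids_consec R (b # c # xs)"
| "avoids_consec R xs \<longleftrightarrow> True"

lemma avoids_consec_iff_nth:
  "avoids_consec R p \<longleftrightarrow> (\<forall>i. i + 2 < length p \<longrightarrow> \<not> R (p ! i) (p ! (i + 1)) (p ! (i + 2)))"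
proof (induction R p rule: avoids_consec.induct)
  case (1 R a b c xs)
  show ?case
    unfolding avoids_consec.simps 1 by (subst (2) all_nat_split) simp
qed auto

text \<open>Words with fewer than two letters qualify: so short a tail forms no window with the
  minimum in front of it.\<close>

fun starts_with :: "(nat \<Rightarrow> nat \<Rightarrow> bool) \<Rightarrow> nat list \<Rightarrow> bool" where
  "starts_with r (a # b # xs) \<longleftrightarrow> r a b"
| "starts_with r xs \<longleftrightarrow> True"

lemma avoids_consec_butlast: "avoids_consec R (p @ [x]) \<Longrightarrow> avoids_consec R p"
  by (induction R p rule: avoids_consec.induct) auto

lemma starts_with_butlast: "starts_with r (p @ [x]) \<Longrightarrow> starts_with r p"
  by (induction r p rule: starts_with.induct) auto

text \<open>Both patterns begin with their smallest letter, so a window with \<open>m\<close> in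
  second or third place never matches. The only live window is \<open>m\<close> with the first two
  letters of \<open>\<tau>\<close>, which must descend for 123 and ascend for 132.\<close>

lemma avoids_consec_min:
  assumes "\<forall>x\<in>set \<sigma> \<union> set \<tau>. m < x" "distinct \<tau>"
  shows "avoids_consec rel123 (\<sigma> @ m # \<tau>) \<longleftrightarrow>
      avoids_consec rel123 \<sigma> \<and> avoids_consec rel123 \<tau> \<and> starts_with (>) \<tau>" (is ?A)
    and "avoids_consec rel132 (\<sigma> @ m # \<tau>) \<longleftrightarrow>
      avoids_consec rel132 \<sigma> \<and> avoids_consec rel132 \<tau> \<and> starts_with (<) \<tau>" (is ?B)
proof -
  have *: "avoids_consec R (\<sigma> @ m # \<tau>) \<longleftrightarrow>
      avoids_consec R \<sigma> \<and> avoids_consec R \<tau> \<and> starts_with (\<lambda>a b. \<not> R m a b) \<tau>"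
    if "R \<in> {rel123, rel132}" for R
    using assms(1)
  proof (induction \<sigma> rule: induct_list012)
    case 1
    then show ?case by (cases \<tau> rule: remdups_adj.cases) auto
  next
    case (2 x)
    then show ?case using that by (cases \<tau> rule: remdups_adj.cases) (auto simp: rel_defs)
  next
    case (3 x y zs)
    then show ?case using that by (cases zs) (auto simp: rel_defs)
  qed
  have "starts_with (\<lambda>a b. \<not> rel123 m a b) \<tau> \<longleftrightarrow> starts_with (>) \<tau>"
    "starts_with (\<lambda>a b. \<not> rel132 m a b) \<tau> \<longleftrightarrow> starts_with (<) \<tau>"
    using assms by (cases \<tau> rule: remdups_adj.cases; force simp: rel_defs)+
  then show ?A ?B
    using *[of rel123] *[of rel132] by simp_all
qed

text \<open>A minimum in second place creates an initial descent, one in first place an initial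
  ascent; further back it does not touch the first two letters.\<close>

lemma starts_with_min:
  assumes "\<forall>x\<in>set \<sigma> \<union> set \<tau>. m < x"
  shows "starts_with (<) (\<sigma> @ m # \<tau>) \<longleftrightarrow> length \<sigma> \<noteq> 1 \<and> starts_with (<) \<sigma>"
    and "starts_with (>) (\<sigma> @ m # \<tau>) \<longleftrightarrow> (\<sigma> = [] \<longrightarrow> \<tau> = []) \<and> starts_with (>) \<sigma>"
  using assms by (cases \<sigma> rule: remdups_adj.cases; cases \<tau>; auto)+

definition consec123 :: "nat set \<Rightarrow> nat" where
  "consec123 = num_arr (avoids_consec rel123)"

definition consec132 :: "nat set \<Rightarrow> nat" where
  "consec132 = num_arr (avoids_consec rel132)"

definition consec123_desc :: "nat set \<Rightarrow> nat" where
  "consec123_desc = num_arr (\<lambda>p. avoids_consec rel123 p \<and> starts_with (>) p)"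

definition consec132_asc :: "nat set \<Rightarrow> nat" where
  "consec132_asc = num_arr (\<lambda>p. avoids_consec rel132 p \<and> starts_with (<) p)"

lemmas consec_defs = consec123_def consec132_def consec123_desc_def consec132_asc_def

lemma consec123_rec:
  assumes "finite A" "A \<noteq> {}"
  shows "consec123 A = (\<Sum>S\<in>Pow (A - {Min A}). consec123 S * consec123_desc (A - {Min A} - S))"
  unfolding consec_defs
  by (rule num_arr_split_min[OF assms]) (simp add: avoids_consec_min Min_less_split assms)

lemma consec132_rec:
  assumes "finite A" "A \<noteq> {}"
  shows "consec132 A = (\<Sum>S\<in>Pow (A - {Min A}). consec132 S * consec132_asc (A - {Min A} - S))"
  unfolding consec_defs
  by (rule num_arr_split_min[OF assms]) (simp add: avoids_consec_min Min_less_split assms)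

lemma consec_empty [simp]:
  "consec123 {} = 1" "consec132 {} = 1" "consec123_desc {} = 1" "consec132_asc {} = 1"
  by (simp_all add: consec_defs num_arr_empty)

lemma consec_singleton [simp]:
  "consec123 {x} = 1" "consec132 {x} = 1" "consec123_desc {x} = 1" "consec132_asc {x} = 1"
  by (simp_all add: consec_defs num_arr_singleton)

text \<open>Small subsets are singled out because the two recurrences that follow have different
  shapes only there.\<close>

lemma sum_Pow_split_card:
  assumes "finite B"
  shows "sum f (Pow B) = f {} + (\<Sum>x\<in>B. f {x}) + (\<Sum>S | S \<subseteq> B \<and> card S \<ge> 2. f S)"
proof -
  let ?C = "{S. S \<subseteq> B \<and> card S \<ge> 2}"
  have eq: "Pow B = insert {} ((\<lambda>x. {x}) ` B \<union> ?C)"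
  proof (intro equalityI subsetI)
    fix S assume S: "S \<in> Pow B"
    then have "finite S" using assms finite_subset by auto
    moreover consider "card S = 0" | "card S = 1" | "card S \<ge> 2" by linarith
    ultimately show "S \<in> insert {} ((\<lambda>x. {x}) ` B \<union> ?C)"
      using S by cases (auto simp: card_1_singleton_iff)
  qed auto
  have "sum f (Pow B) = f {} + sum f ((\<lambda>x. {x}) ` B \<union> ?C)"
    unfolding eq using assms by (subst sum.insert) auto
  also have "sum f ((\<lambda>x. {x}) ` B \<union> ?C) = sum f ((\<lambda>x. {x}) ` B) + sum f ?C"
    using assms by (intro sum.union_disjoint) auto
  also have "sum f ((\<lambda>x. {x}) ` B) = (\<Sum>x\<in>B. f {x})"
    by (subst sum.reindex) auto
  finally show ?thesis by (simp add: add.assoc)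
qed

text \<open>An initial ascent admits the minimum in first place (\<open>S\<close> empty) and
  excludes it from second place (\<open>S\<close> a singleton).\<close>

lemma consec132_asc_rec:
  assumes A: "finite A" "A \<noteq> {}"
  shows "consec132_asc A = consec132_asc (A - {Min A}) +
    (\<Sum>S | S \<subseteq> A - {Min A} \<and> card S \<ge> 2. consec132_asc S * consec132_asc (A - {Min A} - S))"
proof -
  let ?Q = "\<lambda>p. length p \<noteq> 1 \<and> avoids_consec rel132 p \<and> starts_with (<) p"
  have "consec132_asc A = (\<Sum>S\<in>Pow (A - {Min A}). num_arr ?Q S * consec132_asc (A - {Min A} - S))"
    unfolding consec_defs
    by (rule num_arr_split_min[OF A])
      (auto simp add: avoids_consec_min starts_with_min Min_less_split A)
  also have "\<dots> = num_arr ?Q {} * consec132_asc (A - {Min A})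
      + (\<Sum>x\<in>A - {Min A}. num_arr ?Q {x} * consec132_asc (A - {Min A} - {x}))
      + (\<Sum>S | S \<subseteq> A - {Min A} \<and> card S \<ge> 2. num_arr ?Q S * consec132_asc (A - {Min A} - S))"
    using A by (subst sum_Pow_split_card) auto
  also have "(\<Sum>S | S \<subseteq> A - {Min A} \<and> card S \<ge> 2. num_arr ?Q S * consec132_asc (A - {Min A} - S)) =
      (\<Sum>S | S \<subseteq> A - {Min A} \<and> card S \<ge> 2. consec132_asc S * consec132_asc (A - {Min A} - S))"
  proof (rule sum.cong)
    fix S assume "S \<in> {S. S \<subseteq> A - {Min A} \<and> card S \<ge> 2}"
    then have "arrangements ?Q S = arrangements (\<lambda>p. avoids_consec rel132 p \<and> starts_with (<) p) S"
      by (auto simp: in_arrangements dest!: distinct_card)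
    then show "num_arr ?Q S * consec132_asc (A - {Min A} - S) = consec132_asc S * consec132_asc (A - {Min A} - S)"
      by (simp add: num_arr_def consec_defs)
  qed simp
  finally show ?thesis by (simp add: num_arr_empty num_arr_singleton)
qed

text \<open>The opposite situation: an initial descent excludes the minimum from first place, unless
  it is the only letter, and admits any single letter in front of it.\<close>

lemma consec123_desc_rec:
  assumes A: "finite A" "A - {Min A} \<noteq> {}"
  shows "consec123_desc A = (\<Sum>x\<in>A - {Min A}. consec123_desc (A - {Min A} - {x})) +
    (\<Sum>S | S \<subseteq> A - {Min A} \<and> card S \<ge> 2. consec123_desc S * consec123_desc (A - {Min A} - S))"
proof -
  let ?T = "\<lambda>S p. (S = {} \<longrightarrow> p = []) \<and> avoids_consec rel123 p \<and> starts_with (>) p"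
  have A': "A \<noteq> {}" using A by auto
  have "consec123_desc A = (\<Sum>S\<in>Pow (A - {Min A}). consec123_desc S * num_arr (?T S) (A - {Min A} - S))"
    unfolding consec_defs
    by (rule num_arr_split_min[OF A(1) A'])
      (auto simp add: avoids_consec_min starts_with_min Min_less_split A)
  also have "\<dots> = consec123_desc {} * num_arr (?T {}) (A - {Min A})
      + (\<Sum>x\<in>A - {Min A}. consec123_desc {x} * num_arr (?T {x}) (A - {Min A} - {x}))
      + (\<Sum>S | S \<subseteq> A - {Min A} \<and> card S \<ge> 2. consec123_desc S * num_arr (?T S) (A - {Min A} - S))"
    using A by (subst sum_Pow_split_card) auto
  also have "num_arr (?T {}) (A - {Min A}) = 0"
    using A by (auto simp: num_arr_def in_arrangements)
  also have "(\<Sum>S | S \<subseteq> A - {Min A} \<and> card S \<ge> 2. consec123_desc S * num_arr (?T S) (A - {Min A} - S)) =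
      (\<Sum>S | S \<subseteq> A - {Min A} \<and> card S \<ge> 2. consec123_desc S * consec123_desc (A - {Min A} - S))"
  proof (rule sum.cong)
    fix S assume "S \<in> {S. S \<subseteq> A - {Min A} \<and> card S \<ge> 2}"
    then have "S \<noteq> {}" by auto
    then show "consec123_desc S * num_arr (?T S) (A - {Min A} - S) =
        consec123_desc S * consec123_desc (A - {Min A} - S)"
      by (simp add: consec123_desc_def)
  qed simp
  finally show ?thesis by (simp add: consec123_desc_def num_arr_singleton)
qed

lemma consec132_asc_delete:
  assumes "finite A" "A \<noteq> {}"
  shows "consec132_asc A \<le> (\<Sum>x\<in>A. consec132_asc (A - {x}))"
  unfolding consec132_asc_def
  by (rule num_arr_le_delete_last[OF assms]) (use avoids_consec_butlast starts_with_butlast in blast)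

text \<open>The summands with \<open>card S \<ge> 2\<close> correspond. What remains is the single
  term \<open>consec132_asc B\<close> against a sum over the letters of \<open>B\<close>; deleting
  the last letter spreads the former over the latter.\<close>

lemma consec132_asc_le_consec123_desc:
  "finite A \<Longrightarrow> consec132_asc A \<le> consec123_desc A"
proof (induction "card A" arbitrary: A rule: less_induct)
  case less
  have IH: "consec132_asc S \<le> consec123_desc S" if "S \<subset> A" for S
    using less that by (meson finite_subset psubset_card_mono psubset_imp_subset)
  show ?case
  proof (cases "A - {Min A} = {}")
    case True
    then have "A = {} \<or> A = {Min A}" by auto
    then show ?thesis by (metis consec_empty(3,4) consec_singleton(3,4) le_refl)
  next
    case False
    define B where "B = A - {Min A}"
    have A: "A \<noteq> {}" "finite B" "B \<noteq> {}" "B \<subset> A"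
      using False less.prems by (auto simp: B_def intro!: Min_in)
    have "consec132_asc B \<le> (\<Sum>x\<in>B. consec132_asc (B - {x}))"
      using A by (intro consec132_asc_delete)
    also have "\<dots> \<le> (\<Sum>x\<in>B. consec123_desc (B - {x}))"
      using A by (intro sum_mono IH) auto
    finally have 1: "consec132_asc B \<le> (\<Sum>x\<in>B. consec123_desc (B - {x}))" .
    have 2: "(\<Sum>S | S \<subseteq> B \<and> card S \<ge> 2. consec132_asc S * consec132_asc (B - S))
        \<le> (\<Sum>S | S \<subseteq> B \<and> card S \<ge> 2. consec123_desc S * consec123_desc (B - S))"
      using A by (intro sum_mono mult_mono IH) auto
    show ?thesis
      using 1 2 consec132_asc_rec[OF less.prems A(1)] consec123_desc_rec[OF less.prems False]
      by (simp add: B_def)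
  qed
qed

text \<open>With two letters besides the minimum, the exceptional part of the recurrence is 1 for
  132, but 1 for each of the two letters, hence 2, for 123.\<close>

lemma consec132_asc_less_consec123_desc:
  assumes "card A = 3"
  shows "consec132_asc A < consec123_desc A"
proof -
  have fin: "finite A" using assms by (metis card.infinite zero_neq_numeral)
  have A: "A \<noteq> {}" using assms by auto
  obtain x y where xy: "A - {Min A} = {x, y}" "x \<noteq> y"
    using assms fin A by (metis Min_in card_2_iff card_Diff_singleton diff_Suc_1 numeral_2_eq_2 numeral_3_eq_3)
  have two: "consec132_asc {x, y} = 1"
  proof -
    have "Min {x, y} \<in> {x, y}" by (rule Min_in) auto
    then have "card ({x, y} - {Min {x, y}}) = 1"
      using \<open>x \<noteq> y\<close> by (simp only: card_Diff_singleton) simp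
    then obtain z where z: "{x, y} - {Min {x, y}} = {z}" by (rule card_1_singletonE)
    have "card S \<le> 1" if "S \<subseteq> {z}" for S
      using card_mono[of "{z}" S] that by simp
    then have none: "{S. S \<subseteq> {z} \<and> card S \<ge> 2} = {}"
      by (metis (no_types, lifting) Collect_empty_eq not_less_eq_eq numeral_2_eq_2 One_nat_def)
    have "consec132_asc {x, y} = consec132_asc {z}"
      using consec132_asc_rec[of "{x, y}"] unfolding z none by simp
    then show ?thesis by simp
  qed
  have "consec132_asc S * consec132_asc ({x, y} - S) \<le> consec123_desc S * consec123_desc ({x, y} - S)"
    if "S \<subseteq> {x, y}" for S
    using that by (intro mult_mono consec132_asc_le_consec123_desc) (auto intro: finite_subset)
  then have "(\<Sum>S | S \<subseteq> {x, y} \<and> card S \<ge> 2. consec132_asc S * consec132_asc ({x, y} - S))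
      \<le> (\<Sum>S | S \<subseteq> {x, y} \<and> card S \<ge> 2. consec123_desc S * consec123_desc ({x, y} - S))"
    by (intro sum_mono) auto
  moreover have "(\<Sum>z\<in>{x, y}. consec123_desc ({x, y} - {z})) = 2"
    using xy by (simp add: insert_Diff_if)
  ultimately show ?thesis
    using consec132_asc_rec[OF fin A] consec123_desc_rec[OF fin] two xy by simp
qed

lemma consec132_le_consec123: "finite A \<Longrightarrow> consec132 A \<le> consec123 A"
proof (induction "card A" arbitrary: A rule: less_induct)
  case less
  show ?case
  proof (cases "A = {}")
    case False
    then have "Min A \<in> A" using less.prems by simp
    then have "consec132 S \<le> consec123 S" if "S \<subseteq> A - {Min A}" for S
      using that less by (intro less.hyps psubset_card_mono) (auto intro: finite_subset)
    then show ?thesis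
      unfolding consec132_rec[OF less.prems False] consec123_rec[OF less.prems False]
      using less.prems by (intro sum_mono mult_mono consec132_asc_le_consec123_desc) auto
  qed simp
qed

lemma consec132_pos: "finite A \<Longrightarrow> consec132 A > 0"
  unfolding consec132_def
proof (rule num_arr_pos)
  let ?p = "sorted_list_of_set A"
  assume "finite A"
  then show "set ?p = A" "distinct ?p" by auto
  have "sorted p \<Longrightarrow> avoids_consec rel132 p" for p
    by (induction rel132 p rule: avoids_consec.induct) (auto simp: rel_defs)
  then show "avoids_consec rel132 ?p" by simp
qed

lemma consec132_less_consec123:
  assumes fin: "finite A" and card: "card A \<ge> 4"
  shows "consec132 A < consec123 A"
proof -
  have A: "A \<noteq> {}" using card by auto
  let ?B = "A - {Min A}"
  have B: "finite ?B" "card ?B \<ge> 3" using fin A card by auto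
  then obtain R where R: "R \<subseteq> ?B" "card R = 3" by (meson obtain_subset_with_card_n)
  have le: "consec132 S * consec132_asc (?B - S) \<le> consec123 S * consec123_desc (?B - S)"
    if "S \<subseteq> ?B" for S
    using that B by (intro mult_mono consec132_le_consec123 consec132_asc_le_consec123_desc)
      (auto intro: finite_subset)
  have "(\<Sum>S\<in>Pow ?B. consec132 S * consec132_asc (?B - S))
      < (\<Sum>S\<in>Pow ?B. consec123 S * consec123_desc (?B - S))"
  proof (rule sum_strict_mono_ex1)
    \<comment> \<open>All but three of the remaining letters go in front of the minimum, so the tail
      uses the three letters of \<open>R\<close>, where the second factors differ. Positivity of
      \<open>consec132 ?S\<close> keeps the product strict. The minimum and \<open>R\<close> make up
      the four letters required.\<close>
    let ?S = "?B - R"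
    have "?B - ?S = R" using R by auto
    then have "consec132 ?S * consec132_asc (?B - ?S) < consec123 ?S * consec123_desc (?B - ?S)"
      using consec132_asc_less_consec123_desc[OF R(2)] consec132_pos[of ?S]
        consec132_le_consec123[of ?S] B by (simp add: mult_le_less_imp_less)
    then show "\<exists>S\<in>Pow ?B. consec132 S * consec132_asc (?B - S) < consec123 S * consec123_desc (?B - S)"
      by blast
  qed (use B le in auto)
  then show ?thesis
    unfolding consec132_rec[OF fin A] consec123_rec[OF fin A] .
qed

lemma consecutive_123_132:
  assumes "n \<ge> 4"
  shows "card (Av n [1,3,2] Adjacent Adjacent) < card (Av n [1,2,3] Adjacent Adjacent)"
proof -
  have "Av n q Adjacent Adjacent = arrangements (avoids_consec R) {1..n}"
    if "\<And>a b c. order_isomorphic [a, b, c] q \<longleftrightarrow> R a b c" for R q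
    by (rule Av_eq_arrangements) (auto simp: avoids_consec_iff_nth occurrence_def that)
  from this[OF order_isomorphic_123] this[OF order_isomorphic_132]
  show ?thesis
    using consec132_less_consec123[of "{1..n}"] assms by (simp add: consec_defs num_arr_def)
qed

section \<open>A separated first letter and an adjacent pair\<close>

definition avoids_sep_adj :: "(nat \<Rightarrow> nat \<Rightarrow> nat \<Rightarrow> bool) \<Rightarrow> nat list \<Rightarrow> bool" where
  "avoids_sep_adj R p \<longleftrightarrow>
     (\<forall>i j. i + 2 \<le> j \<longrightarrow> Suc j < length p \<longrightarrow> \<not> R (p ! i) (p ! j) (p ! Suc j))"

lemma avoids_sep_adjD:
  "\<lbrakk>avoids_sep_adj R p; i + 2 \<le> j; Suc j < length p\<rbrakk> \<Longrightarrow> \<not> R (p ! i) (p ! j) (p ! Suc j)"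
  by (simp add: avoids_sep_adj_def)

text \<open>Cases by the place of a triple relative to \<open>m\<close>; the hypothesis excludes
  \<open>m\<close> as last letter. \<open>butlast\<close> appears because the last letter of
  \<open>\<sigma>\<close> is not separated from \<open>m\<close>, and \<open>1 \<le> j\<close>
  because \<open>m\<close> is not separated from \<open>hd \<tau>\<close>. Letters of
  \<open>\<sigma>\<close> are separated from all of \<open>\<tau>\<close> by \<open>m\<close>
  itself.\<close>

lemma avoids_sep_adj_split:
  assumes m: "\<And>a b. \<lbrakk>a \<in> set \<sigma>; b \<in> set \<sigma>\<rbrakk> \<Longrightarrow> \<not> R a b m"
  shows "avoids_sep_adj R (\<sigma> @ m # \<tau>) \<longleftrightarrow>
    avoids_sep_adj R \<sigma> \<and> avoids_sep_adj R \<tau> \<and>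
    (\<forall>a\<in>set (butlast \<sigma>). \<tau> \<noteq> [] \<longrightarrow> \<not> R a m (hd \<tau>)) \<and>
    (\<forall>j. Suc j < length \<tau> \<longrightarrow> (\<forall>a\<in>set \<sigma>. \<not> R a (\<tau> ! j) (\<tau> ! Suc j))) \<and>
    (\<forall>j. 1 \<le> j \<longrightarrow> Suc j < length \<tau> \<longrightarrow> \<not> R m (\<tau> ! j) (\<tau> ! Suc j))"
    (is "?L \<longleftrightarrow> ?A \<and> ?B \<and> ?C \<and> ?D \<and> ?E")
proof
  let ?p = "\<sigma> @ m # \<tau>" and ?s = "length \<sigma>"
  have nth_m: "?p ! ?s = m" by simp
  have nth_\<tau>: "?p ! (Suc (?s + k)) = \<tau> ! k" for k by (simp add: nth_append)
  have nth_\<sigma>: "k < ?s \<Longrightarrow> ?p ! k = \<sigma> ! k" for k by (simp add: nth_append)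
  {
    assume L: ?L
    have ?A unfolding avoids_sep_adj_def
    proof (intro allI impI)
      fix i j assume "i + 2 \<le> j" "Suc j < ?s"
      with avoids_sep_adjD[OF L, of i j] show "\<not> R (\<sigma> ! i) (\<sigma> ! j) (\<sigma> ! Suc j)"
        by (simp add: nth_\<sigma>)
    qed
    moreover have ?B unfolding avoids_sep_adj_def
    proof (intro allI impI)
      fix i j assume "i + 2 \<le> j" "Suc j < length \<tau>"
      with avoids_sep_adjD[OF L, of "Suc (?s + i)" "Suc (?s + j)"] nth_\<tau>[of i] nth_\<tau>[of j] nth_\<tau>[of "Suc j"]
      show "\<not> R (\<tau> ! i) (\<tau> ! j) (\<tau> ! Suc j)" by simp
    qed
    moreover have ?C
    proof (intro ballI impI)
      fix a assume "a \<in> set (butlast \<sigma>)" "\<tau> \<noteq> []"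
      then obtain i where "i + 1 < ?s" "a = \<sigma> ! i"
        by (force simp: in_set_conv_nth nth_butlast less_diff_conv)
      with avoids_sep_adjD[OF L, of i ?s] nth_\<tau>[of 0] nth_m \<open>\<tau> \<noteq> []\<close> show "\<not> R a m (hd \<tau>)"
        by (simp add: nth_\<sigma> hd_conv_nth)
    qed
    moreover have ?D
    proof (intro allI ballI impI)
      fix j a assume "Suc j < length \<tau>" "a \<in> set \<sigma>"
      then obtain i where "i < ?s" "a = \<sigma> ! i"
        by (auto simp: in_set_conv_nth)
      with avoids_sep_adjD[OF L, of i "Suc (?s + j)"] nth_\<tau>[of j] nth_\<tau>[of "Suc j"] \<open>Suc j < _\<close>
      show "\<not> R a (\<tau> ! j) (\<tau> ! Suc j)" by (simp add: nth_\<sigma>)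
    qed
    moreover have ?E
    proof (intro allI impI)
      fix j assume "1 \<le> j" "Suc j < length \<tau>"
      with avoids_sep_adjD[OF L, of "?s" "Suc (?s + j)"] nth_\<tau>[of j] nth_\<tau>[of "Suc j"] nth_m
      show "\<not> R m (\<tau> ! j) (\<tau> ! Suc j)" by simp
    qed
    ultimately show "?A \<and> ?B \<and> ?C \<and> ?D \<and> ?E" by blast
  next
    assume *: "?A \<and> ?B \<and> ?C \<and> ?D \<and> ?E"
    show ?L unfolding avoids_sep_adj_def
    proof (intro allI impI)
      fix i j assume ij: "i + 2 \<le> j" "Suc j < length ?p"
      consider "Suc j < ?s" | "Suc j = ?s" | "j = ?s" | k where "j = Suc (?s + k)"
        by (metis Suc_lessI less_iff_Suc_add linorder_neqE_nat)
      then show "\<not> R (?p ! i) (?p ! j) (?p ! Suc j)"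
      proof cases
        case 1
        then show ?thesis using * ij by (simp add: nth_\<sigma> avoids_sep_adj_def)
      next
        case 2
        then have "?p ! i \<in> set \<sigma>" "?p ! j \<in> set \<sigma>" "?p ! Suc j = m"
          using ij by (auto simp: nth_\<sigma> nth_m)
        then show ?thesis using m by metis
      next
        case 3
        have "i < length (butlast \<sigma>)" using ij 3 by simp
        then have "\<sigma> ! i \<in> set (butlast \<sigma>)" by (metis nth_butlast nth_mem)
        moreover have "\<tau> \<noteq> []" using ij 3 by auto
        ultimately show ?thesis
          using * 3 ij nth_\<tau>[of 0] by (simp add: nth_\<sigma> hd_conv_nth)
      next
        case 4
        then have k: "Suc k < length \<tau>" "?p ! j = \<tau> ! k" "?p ! Suc j = \<tau> ! Suc k"
          using ij nth_\<tau>[of k] nth_\<tau>[of "Suc k"] by auto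
        consider "i < ?s" | "i = ?s" | l where "i = Suc (?s + l)"
          by (metis less_iff_Suc_add linorder_neqE_nat)
        then show ?thesis
        proof cases
          case 1
          then show ?thesis using * k by (simp add: nth_\<sigma>)
        next
          case 2
          then show ?thesis using * k ij 4 by simp
        next
          case (3 l)
          then have "l + 2 \<le> k" "?p ! i = \<tau> ! l" using ij 4 nth_\<tau>[of l] by auto
          then show ?thesis using * k by (simp add: avoids_sep_adj_def)
        qed
      qed
    qed
  }
qed

text \<open>The tails behind the minimum that 1\<box>23 allows. With \<open>m\<close> as the 1, all
  letters after the first must descend. The first two letters of the tail are too close to
  \<open>m\<close> and are tested only against \<open>S\<close>; as the rest is sorted, this test
  depends on sets alone.\<close>

fun desc_tail :: "nat set \<Rightarrow> nat list \<Rightarrow> bool" where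
  "desc_tail S [] \<longleftrightarrow> True"
| "desc_tail S (x # ys) \<longleftrightarrow> sorted_wrt (>) ys \<and> ((\<forall>y\<in>set ys. y < x) \<or> (\<forall>a\<in>S. x < a))"

text \<open>The analogue for 1\<box>32. The existential speaks of the first letter of the rest,
  which is its smallest.\<close>

fun asc_tail :: "nat set \<Rightarrow> nat list \<Rightarrow> bool" where
  "asc_tail S [] \<longleftrightarrow> True"
| "asc_tail S (x # ys) \<longleftrightarrow> sorted_wrt (<) ys \<and> ((\<forall>y\<in>set ys. x < y) \<or> (\<exists>y\<in>set ys. \<forall>a\<in>S. y < a))"

text \<open>Serves both patterns: \<open>r\<close> is the order that \<open>m\<close>, as the 1,
  forces on \<open>ys\<close>. By \<open>mono\<close> a pair in this order is harmless for every
  other first letter as well, so only the pair \<open>x\<close>, \<open>hd ys\<close> has to be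
  tested against \<open>\<sigma>\<close>.\<close>

lemma avoids_sep_adj_min:
  assumes min: "\<And>a b. \<lbrakk>m < a; m < b\<rbrakk> \<Longrightarrow> \<not> R a b m" "\<And>a b. m < a \<Longrightarrow> \<not> R a m b"
    and r: "\<And>b c. \<lbrakk>m < b; m < c; b \<noteq> c\<rbrakk> \<Longrightarrow> \<not> R m b c \<longleftrightarrow> r b c"
    and mono: "\<And>a b c. \<lbrakk>m < a; r b c\<rbrakk> \<Longrightarrow> \<not> R a b c"
    and trans: "transp r"
    and m: "\<forall>x\<in>set \<sigma> \<union> set (x # ys). m < x" and dist: "distinct ys"
  shows "avoids_sep_adj R (\<sigma> @ m # x # ys) \<longleftrightarrow>
    avoids_sep_adj R \<sigma> \<and> sorted_wrt r ys \<and> (ys \<noteq> [] \<longrightarrow> (\<forall>a\<in>set \<sigma>. \<not> R a x (hd ys)))"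
proof -
  let ?\<tau> = "x # ys"
  have split: "avoids_sep_adj R (\<sigma> @ m # ?\<tau>) \<longleftrightarrow>
    avoids_sep_adj R \<sigma> \<and> avoids_sep_adj R ?\<tau> \<and>
    (\<forall>a\<in>set (butlast \<sigma>). ?\<tau> \<noteq> [] \<longrightarrow> \<not> R a m (hd ?\<tau>)) \<and>
    (\<forall>j. Suc j < length ?\<tau> \<longrightarrow> (\<forall>a\<in>set \<sigma>. \<not> R a (?\<tau> ! j) (?\<tau> ! Suc j))) \<and>
    (\<forall>j. 1 \<le> j \<longrightarrow> Suc j < length ?\<tau> \<longrightarrow> \<not> R m (?\<tau> ! j) (?\<tau> ! Suc j))"
    by (rule avoids_sep_adj_split) (use m min in auto)
  have butlast: "m < a" if "a \<in> set (butlast \<sigma>)" for a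
    using m in_set_butlastD[OF that] by simp
  have E: "(\<forall>j. 1 \<le> j \<longrightarrow> Suc j < length ?\<tau> \<longrightarrow> \<not> R m (?\<tau> ! j) (?\<tau> ! Suc j))
      \<longleftrightarrow> sorted_wrt r ys" (is "?E \<longleftrightarrow> _")
  proof -
    have "?E \<longleftrightarrow> (\<forall>j. Suc j < length ys \<longrightarrow> \<not> R m (ys ! j) (ys ! Suc j))"
      by (metis Suc_le_D One_nat_def Suc_less_eq le_add1 length_Cons nth_Cons_Suc plus_1_eq_Suc)
    also have "\<dots> \<longleftrightarrow> (\<forall>j. Suc j < length ys \<longrightarrow> r (ys ! j) (ys ! Suc j))"
    proof -
      have "\<not> R m (ys ! j) (ys ! Suc j) \<longleftrightarrow> r (ys ! j) (ys ! Suc j)" if "Suc j < length ys" for j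
        using dist that m by (intro r) (auto simp: nth_eq_iff_index_eq)
      then show ?thesis by auto
    qed
    also have "\<dots> \<longleftrightarrow> sorted_wrt r ys"
      by (simp add: sorted_wrt_iff_nth_Suc_transp[OF trans])
    finally show ?thesis .
  qed
  have D: "(\<forall>j. Suc j < length ?\<tau> \<longrightarrow> (\<forall>a\<in>set \<sigma>. \<not> R a (?\<tau> ! j) (?\<tau> ! Suc j)))
      \<longleftrightarrow> (ys \<noteq> [] \<longrightarrow> (\<forall>a\<in>set \<sigma>. \<not> R a x (hd ys)))" if srt: "sorted_wrt r ys"
  proof -
    have "\<not> R a (?\<tau> ! Suc j) (?\<tau> ! Suc (Suc j))" if "Suc (Suc j) < length ?\<tau>" "a \<in> set \<sigma>" for a j
      using sorted_wrt_nth_less[OF srt, of j "Suc j"] that m mono[of a] by simp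
    then show ?thesis by (subst all_nat_split) (auto simp: hd_conv_nth)
  qed
  have B: "avoids_sep_adj R ?\<tau>" if srt: "sorted_wrt r ys"
    unfolding avoids_sep_adj_def
  proof (intro allI impI)
    fix i j assume ij: "i + 2 \<le> j" "Suc j < length ?\<tau>"
    then obtain k where k: "j = Suc k" "Suc k < length ys" by (cases j) auto
    have "m < ?\<tau> ! i" using m ij nth_mem[of i ?\<tau>] by auto
    then show "\<not> R (?\<tau> ! i) (?\<tau> ! j) (?\<tau> ! Suc j)"
      using sorted_wrt_nth_less[OF srt, of k j] k by (intro mono) auto
  qed
  show ?thesis
    unfolding split E using B D butlast min(2) by auto
qed

lemma avoids_sep_adj_123_min:
  assumes m: "\<forall>x\<in>set \<sigma> \<union> set \<tau>. m < x" and dist: "distinct \<tau>" "set \<sigma> \<inter> set \<tau> = {}"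
  shows "avoids_sep_adj rel123 (\<sigma> @ m # \<tau>) \<longleftrightarrow> avoids_sep_adj rel123 \<sigma> \<and> desc_tail (set \<sigma>) \<tau>"
proof (cases \<tau>)
  case Nil
  show ?thesis
    using m by (subst avoids_sep_adj_split) (auto simp: Nil rel_defs avoids_sep_adj_def[of _ "[]"])
next
  case (Cons x ys)
  have "avoids_sep_adj rel123 (\<sigma> @ m # \<tau>) \<longleftrightarrow> avoids_sep_adj rel123 \<sigma> \<and> sorted_wrt (>) ys \<and>
      (ys \<noteq> [] \<longrightarrow> (\<forall>a\<in>set \<sigma>. \<not> rel123 a x (hd ys)))"
    unfolding Cons
    by (rule avoids_sep_adj_min) (use m dist Cons in \<open>auto simp: rel_defs transp_def\<close>)
  moreover have "(ys \<noteq> [] \<longrightarrow> (\<forall>a\<in>set \<sigma>. \<not> rel123 a x (hd ys))) \<longleftrightarrow>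
      (\<forall>y\<in>set ys. y < x) \<or> (\<forall>a\<in>set \<sigma>. x < a)" if "sorted_wrt (>) ys"
    using dist that unfolding Cons by (cases ys) (force simp: rel_defs)+
  ultimately show ?thesis by (auto simp: Cons)
qed

lemma avoids_sep_adj_132_min:
  assumes m: "\<forall>x\<in>set \<sigma> \<union> set \<tau>. m < x" and dist: "distinct \<tau>" "set \<sigma> \<inter> set \<tau> = {}"
  shows "avoids_sep_adj rel132 (\<sigma> @ m # \<tau>) \<longleftrightarrow> avoids_sep_adj rel132 \<sigma> \<and> asc_tail (set \<sigma>) \<tau>"
proof (cases \<tau>)
  case Nil
  show ?thesis
    using m by (subst avoids_sep_adj_split) (auto simp: Nil rel_defs avoids_sep_adj_def[of _ "[]"])
next
  case (Cons x ys)
  have "avoids_sep_adj rel132 (\<sigma> @ m # \<tau>) \<longleftrightarrow> avoids_sep_adj rel132 \<sigma> \<and> sorted_wrt (<) ys \<and>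
      (ys \<noteq> [] \<longrightarrow> (\<forall>a\<in>set \<sigma>. \<not> rel132 a x (hd ys)))"
    unfolding Cons
    by (rule avoids_sep_adj_min) (use m dist Cons in \<open>auto simp: rel_defs transp_def\<close>)
  moreover have "(ys \<noteq> [] \<longrightarrow> (\<forall>a\<in>set \<sigma>. \<not> rel132 a x (hd ys))) \<longleftrightarrow>
      (\<forall>y\<in>set ys. x < y) \<or> (\<exists>y\<in>set ys. \<forall>a\<in>set \<sigma>. y < a)" if "sorted_wrt (<) ys"
    using dist that unfolding Cons by (cases ys) (force simp: rel_defs)+
  ultimately show ?thesis by (auto simp: Cons)
qed

text \<open>The rest of a tail is sorted, hence forced by the first letter; counting tails means
  counting admissible first letters.\<close>

lemma num_arr_desc_tail:
  assumes "finite R" "R \<noteq> {}"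
  shows "num_arr (desc_tail S) R = card {x\<in>R. (\<forall>y\<in>R - {x}. y < x) \<or> (\<forall>a\<in>S. x < a)}" (is "_ = card ?X")
proof -
  let ?f = "\<lambda>x. x # rev (sorted_list_of_set (R - {x}))"
  have "arrangements (desc_tail S) R = ?f ` ?X"
  proof (intro equalityI subsetI)
    fix p assume "p \<in> arrangements (desc_tail S) R"
    then have p: "set p = R" "distinct p" "desc_tail S p" by (auto simp: in_arrangements)
    with assms obtain x ys where s: "p = x # ys" by (cases p) auto
    with p have ys: "set ys = R - {x}" "x \<in> R" "distinct ys" "sorted_wrt (>) ys" by auto
    from ys have "sorted_wrt (<) (rev ys)" by (simp add: sorted_wrt_rev)
    with ys have "rev ys = sorted_list_of_set (R - {x})"
      using assms by (intro strict_sorted_equal) auto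
    then have "ys = rev (sorted_list_of_set (R - {x}))" by (metis rev_rev_ident)
    moreover have "x \<in> ?X" using p ys s by auto
    ultimately show "p \<in> ?f ` ?X" using s by blast
  next
    fix p assume "p \<in> ?f ` ?X"
    then obtain x where "x \<in> ?X" "p = ?f x" by blast
    then show "p \<in> arrangements (desc_tail S) R"
      using assms by (simp add: in_arrangements insert_absorb sorted_wrt_rev)
  qed
  moreover have "inj_on ?f ?X" by (auto intro: inj_onI)
  ultimately show ?thesis unfolding num_arr_def by (simp only: card_image)
qed

lemma num_arr_asc_tail:
  assumes "finite R" "R \<noteq> {}"
  shows "num_arr (asc_tail S) R = card {x\<in>R. (\<forall>y\<in>R - {x}. x < y) \<or> (\<exists>y\<in>R - {x}. \<forall>a\<in>S. y < a)}" (is "_ = card ?X")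
proof -
  let ?f = "\<lambda>x. x # sorted_list_of_set (R - {x})"
  have "arrangements (asc_tail S) R = ?f ` ?X"
  proof (intro equalityI subsetI)
    fix p assume "p \<in> arrangements (asc_tail S) R"
    then have p: "set p = R" "distinct p" "asc_tail S p" by (auto simp: in_arrangements)
    with assms obtain x ys where s: "p = x # ys" by (cases p) auto
    with p have ys: "set ys = R - {x}" "x \<in> R" "distinct ys" "sorted_wrt (<) ys" by auto
    with ys have "ys = sorted_list_of_set (R - {x})"
      using assms by (intro strict_sorted_equal) auto
    moreover have "x \<in> ?X" using p ys s by auto
    ultimately show "p \<in> ?f ` ?X" using s by blast
  next
    fix p assume "p \<in> ?f ` ?X"
    then obtain x where "x \<in> ?X" "p = ?f x" by blast
    then show "p \<in> arrangements (asc_tail S) R"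
      using assms by (simp add: in_arrangements insert_absorb)
  qed
  moreover have "inj_on ?f ?X" by (auto intro: inj_onI)
  ultimately show ?thesis unfolding num_arr_def by (simp only: card_image)
qed

lemma num_arr_tail_empty [simp]: "num_arr (desc_tail S) {} = 1" "num_arr (asc_tail S) {} = 1"
  by (simp_all add: num_arr_empty)

definition sep_adj123 :: "nat set \<Rightarrow> nat" where
  "sep_adj123 = num_arr (avoids_sep_adj rel123)"

definition sep_adj132 :: "nat set \<Rightarrow> nat" where
  "sep_adj132 = num_arr (avoids_sep_adj rel132)"

definition sep_adj213 :: "nat set \<Rightarrow> nat" where
  "sep_adj213 = num_arr (avoids_sep_adj rel213)"

lemmas sep_adj_defs = sep_adj123_def sep_adj132_def sep_adj213_def

lemma sep_adj_empty [simp]: "sep_adj123 {} = 1" "sep_adj132 {} = 1" "sep_adj213 {} = 1"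
  by (simp_all add: sep_adj_defs num_arr_empty avoids_sep_adj_def)

lemma sep_adj_singleton [simp]: "sep_adj123 {x} = 1" "sep_adj132 {x} = 1" "sep_adj213 {x} = 1"
  by (simp_all add: sep_adj_defs num_arr_singleton avoids_sep_adj_def)

lemma sep_adj123_rec:
  assumes "finite A" "A \<noteq> {}"
  shows "sep_adj123 A = (\<Sum>S\<in>Pow (A - {Min A}). sep_adj123 S * num_arr (desc_tail S) (A - {Min A} - S))"
  unfolding sep_adj_defs
  by (rule num_arr_split_min[OF assms]) (simp add: avoids_sep_adj_123_min Min_less_split assms)

lemma sep_adj132_rec:
  assumes "finite A" "A \<noteq> {}"
  shows "sep_adj132 A = (\<Sum>S\<in>Pow (A - {Min A}). sep_adj132 S * num_arr (asc_tail S) (A - {Min A} - S))"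
  unfolding sep_adj_defs
  by (rule num_arr_split_min[OF assms]) (simp add: avoids_sep_adj_132_min Min_less_split assms)

text \<open>If some letter of \<open>R\<close> is below all of \<open>S\<close>, then any letter of \<open>R\<close> may start an ascending tail;
  otherwise both kinds of tail start with a forced letter.\<close>

lemma asc_tail_choices:
  fixes R S :: "nat set"
  assumes "y \<in> R" "\<forall>a\<in>S. y < a"
  shows "{x\<in>R. (\<forall>y\<in>R - {x}. x < y) \<or> (\<exists>y\<in>R - {x}. \<forall>a\<in>S. y < a)} = R"
proof (intro equalityI subsetI)
  fix x assume x: "x \<in> R"
  have "\<exists>y\<in>R - {x}. \<forall>a\<in>S. y < a" if "z \<in> R - {x}" "\<not> x < z" for z
  proof (cases "y = x")
    case True
    then have "\<forall>a\<in>S. z < a" using that assms by fastforce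
    then show ?thesis using that by blast
  qed (use assms in blast)
  then show "x \<in> {x\<in>R. (\<forall>y\<in>R - {x}. x < y) \<or> (\<exists>y\<in>R - {x}. \<forall>a\<in>S. y < a)}"
    using x by blast
qed auto

lemma num_arr_desc_tail_le_asc_tail:
  assumes R: "finite R"
  shows "num_arr (desc_tail S) R \<le> num_arr (asc_tail S) R"
proof (cases "R = {}")
  case False
  let ?X = "{x\<in>R. (\<forall>y\<in>R - {x}. y < x) \<or> (\<forall>a\<in>S. x < a)}"
  let ?Y = "{x\<in>R. (\<forall>y\<in>R - {x}. x < y) \<or> (\<exists>y\<in>R - {x}. \<forall>a\<in>S. y < a)}"
  have "card ?X \<le> card ?Y"
  proof (cases "\<exists>y\<in>R. \<forall>a\<in>S. y < a")
    case True
    then have "?Y = R" using asc_tail_choices by blast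
    then show ?thesis using R by (auto intro: card_mono)
  next
    case no: False
    have "?X \<subseteq> {Max R}"
    proof
      fix x assume "x \<in> ?X"
      with no have x: "x \<in> R" "\<forall>y\<in>R - {x}. y < x" by blast+
      have "y \<le> x" if "y \<in> R" for y
        using that x by (cases "y = x") (auto intro: less_imp_le)
      then have "Max R = x" using R x(1) by (intro Max_eqI)
      then show "x \<in> {Max R}" by simp
    qed
    then have "card ?X \<le> 1" using card_mono[of "{Max R}" ?X] by simp
    moreover have "Min R \<in> ?Y"
      using R False by (auto intro: le_neq_implies_less)
    then have "card ?Y > 0" using R by (auto simp: card_gt_0_iff)
    ultimately show ?thesis by linarith
  qed
  then show ?thesis using R False by (simp add: num_arr_desc_tail num_arr_asc_tail)
qed simp

lemma sep_adj123_le_sep_adj132: "finite A \<Longrightarrow> sep_adj123 A \<le> sep_adj132 A"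
proof (induction "card A" arbitrary: A rule: less_induct)
  case less
  show ?case
  proof (cases "A = {}")
    case False
    then have "Min A \<in> A" using less.prems by simp
    then have "sep_adj123 S \<le> sep_adj132 S" if "S \<subseteq> A - {Min A}" for S
      using that less by (intro less.hyps psubset_card_mono) (auto intro: finite_subset)
    then show ?thesis
      unfolding sep_adj123_rec[OF less.prems False] sep_adj132_rec[OF less.prems False]
      using less.prems by (intro sum_mono mult_mono num_arr_desc_tail_le_asc_tail) auto
  qed simp
qed

text \<open>The strict summand is \<open>S = {s}\<close> with \<open>s\<close> the second smallest
  letter of \<open>B\<close>. The smallest, \<open>y\<close>, lies below \<open>s\<close>, so every
  letter of \<open>R\<close> may begin an ascending tail. Of two letters \<open>u < v\<close> above
  \<open>s\<close>, however, \<open>u\<close> cannot begin a descending one. The minimum,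
  \<open>y\<close>, \<open>s\<close>, \<open>u\<close> and \<open>v\<close> are the five letters
  required.\<close>

lemma sep_adj123_less_sep_adj132:
  assumes fin: "finite A" and card: "card A \<ge> 5"
  shows "sep_adj123 A < sep_adj132 A"
proof -
  have A: "A \<noteq> {}" using card by auto
  define B where "B = A - {Min A}"
  have B: "finite B" "card B \<ge> 4" using fin A card by (auto simp: B_def)
  define y where "y = Min B"
  have y: "y \<in> B" "\<forall>z\<in>B - {y}. y < z"
  proof -
    have "B \<noteq> {}" using B(2) by force
    then show "y \<in> B" using B(1) unfolding y_def by (intro Min_in)
    show "\<forall>z\<in>B - {y}. y < z"
      using Min_less[OF B(1)] unfolding y_def by blast
  qed
  define s where "s = Min (B - {y})"
  have s: "s \<in> B - {y}" "\<forall>z\<in>B - {y} - {s}. s < z"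
  proof -
    have "card (B - {y}) \<ge> 3" using B y by simp
    then have "B - {y} \<noteq> {}" by force
    moreover have fin': "finite (B - {y})" using B by simp
    ultimately show "s \<in> B - {y}" unfolding s_def by (intro Min_in)
    show "\<forall>z\<in>B - {y} - {s}. s < z"
      using Min_less[OF fin'] unfolding s_def by blast
  qed
  define R where "R = B - {s}"
  have R: "finite R" "R \<noteq> {}" "y \<in> R" "\<forall>a\<in>{s}. y < a" using B y s by (auto simp: R_def)
  have "card (R - {y}) \<ge> 2" using B y s by (simp add: R_def)
  then obtain u v where uv: "u \<in> R - {y}" "v \<in> R - {y}" "u < v"
    by (metis card_le_Suc0_iff_eq card.infinite linorder_neqE_nat not_less_eq_eq numeral_2_eq_2 zero_le)
  have "u \<notin> {x\<in>R. (\<forall>y\<in>R - {x}. y < x) \<or> (\<forall>a\<in>{s}. x < a)}"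
  proof -
    have "v \<in> R - {u}" "\<not> v < u" "s < u" using uv s(2) by (auto simp: R_def)
    then show ?thesis by fastforce
  qed
  then have "card {x\<in>R. (\<forall>y\<in>R - {x}. y < x) \<or> (\<forall>a\<in>{s}. x < a)} < card R"
    using R uv by (intro psubset_card_mono) auto
  then have less: "num_arr (desc_tail {s}) R < num_arr (asc_tail {s}) R"
    unfolding num_arr_desc_tail[OF R(1,2)] num_arr_asc_tail[OF R(1,2)] asc_tail_choices[OF R(3,4)] .
  have le: "sep_adj123 S * num_arr (desc_tail S) (B - S) \<le> sep_adj132 S * num_arr (asc_tail S) (B - S)"
    if "S \<subseteq> B" for S
    using that B by (intro mult_mono sep_adj123_le_sep_adj132 num_arr_desc_tail_le_asc_tail)
      (auto intro: finite_subset)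
  have "(\<Sum>S\<in>Pow B. sep_adj123 S * num_arr (desc_tail S) (B - S))
      < (\<Sum>S\<in>Pow B. sep_adj132 S * num_arr (asc_tail S) (B - S))"
  proof (rule sum_strict_mono_ex1)
    have "sep_adj123 {s} * num_arr (desc_tail {s}) (B - {s}) < sep_adj132 {s} * num_arr (asc_tail {s}) (B - {s})"
      using less by (simp add: R_def)
    then show "\<exists>S\<in>Pow B. sep_adj123 S * num_arr (desc_tail S) (B - S) < sep_adj132 S * num_arr (asc_tail S) (B - S)"
      using s by blast
  qed (use B le in auto)
  then show ?thesis
    unfolding sep_adj123_rec[OF fin A] sep_adj132_rec[OF fin A] B_def .
qed

lemma Av_sep_adj:
  assumes "\<And>a b c. order_isomorphic [a, b, c] q \<longleftrightarrow> R a b c"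
  shows "Av n q Separated Adjacent = arrangements (avoids_sep_adj R) {1..n}"
  by (rule Av_eq_arrangements) (auto simp: avoids_sep_adj_def occurrence_def assms)

lemma separated_adjacent_123_132:
  assumes "n \<ge> 5"
  shows "card (Av n [1,2,3] Separated Adjacent) < card (Av n [1,3,2] Separated Adjacent)"
proof -
  from Av_sep_adj[OF order_isomorphic_123] Av_sep_adj[OF order_isomorphic_132]
  show ?thesis
    using sep_adj123_less_sep_adj132[of "{1..n}"] assms by (simp add: sep_adj_defs num_arr_def)
qed

section \<open>Reversal and complementation\<close>

definition avoids_adj_sep :: "(nat \<Rightarrow> nat \<Rightarrow> nat \<Rightarrow> bool) \<Rightarrow> nat list \<Rightarrow> bool" where
  "avoids_adj_sep R p \<longleftrightarrow>
     (\<forall>i j. Suc i + 2 \<le> j \<longrightarrow> j < length p \<longrightarrow> \<not> R (p ! i) (p ! Suc i) (p ! j))"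

lemma avoids_adj_sep_rev:
  assumes R: "\<And>a b c. \<lbrakk>a \<in> set p; b \<in> set p; c \<in> set p\<rbrakk> \<Longrightarrow> R a b c \<longleftrightarrow> R' (f c) (f b) (f a)"
  shows "avoids_sep_adj R' (rev (map f p)) \<longleftrightarrow> avoids_adj_sep R p"
proof -
  let ?N = "length p"
  have *: "R' (rev (map f p) ! (?N - Suc j)) (rev (map f p) ! (?N - Suc (Suc i))) (rev (map f p) ! (?N - Suc i))
      \<longleftrightarrow> R (p ! i) (p ! Suc i) (p ! j)" if "Suc i + 2 \<le> j" "j < ?N" for i j
    using R[of "p ! i" "p ! Suc i" "p ! j"] that by (simp add: rev_nth)
  show ?thesis
  proof
    assume L: "avoids_sep_adj R' (rev (map f p))"
    show "avoids_adj_sep R p"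
      unfolding avoids_adj_sep_def
    proof (intro allI impI)
      fix i j assume ij: "Suc i + 2 \<le> j" "j < ?N"
      then have "Suc (?N - Suc (Suc i)) = ?N - Suc i" by simp
      then show "\<not> R (p ! i) (p ! Suc i) (p ! j)"
        using avoids_sep_adjD[OF L, of "?N - Suc j" "?N - Suc (Suc i)"] *[OF ij] ij by simp
    qed
  next
    assume L: "avoids_adj_sep R p"
    show "avoids_sep_adj R' (rev (map f p))"
      unfolding avoids_sep_adj_def
    proof (intro allI impI)
      fix i j assume ij: "i + 2 \<le> j" "Suc j < length (rev (map f p))"
      define i' j' where "i' = ?N - Suc (Suc j)" and "j' = ?N - Suc i"
      have "Suc i' + 2 \<le> j'" "j' < ?N" using ij by (auto simp: i'_def j'_def)
      moreover from this have "\<not> R (p ! i') (p ! Suc i') (p ! j')"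
        using L by (simp add: avoids_adj_sep_def)
      moreover have "?N - Suc j' = i" "?N - Suc (Suc i') = j" "?N - Suc i' = Suc j"
        using ij by (auto simp: i'_def j'_def)
      ultimately show "\<not> R' (rev (map f p) ! i) (rev (map f p) ! j) (rev (map f p) ! Suc j)"
        using *[of i' j'] by simp
    qed
  qed
qed

text \<open>The reverse complement is an involution on the words over \<open>{1..n}\<close>. The
  bounds in the second hypothesis keep the truncated subtraction order-reversing.\<close>

lemma card_Av_adj_sep:
  assumes q: "\<And>a b c. order_isomorphic [a, b, c] q \<longleftrightarrow> R a b c"
    and R: "\<And>a b c. \<lbrakk>a \<le> n; b \<le> n; c \<le> n\<rbrakk> \<Longrightarrow> R a b c \<longleftrightarrow> R' (Suc n - c) (Suc n - b) (Suc n - a)"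
  shows "card (Av n q Adjacent Separated) = num_arr (avoids_sep_adj R') {1..n}"
proof -
  let ?rc = "\<lambda>p. rev (map (\<lambda>x. Suc n - x) p)"
  have Av: "Av n q Adjacent Separated = arrangements (avoids_adj_sep R) {1..n}"
    by (rule Av_eq_arrangements) (auto simp: avoids_adj_sep_def occurrence_def q)
  have compl: "(\<lambda>x. Suc n - x) ` {1..n} = {1..n}"
  proof (intro equalityI subsetI)
    fix x assume "x \<in> {1..n}"
    then have "x = Suc n - (Suc n - x)" "Suc n - x \<in> {1..n}" by auto
    then show "x \<in> (\<lambda>x. Suc n - x) ` {1..n}" by blast
  qed auto
  have inj: "inj_on (\<lambda>x. Suc n - x) {1..n}" by (rule inj_onI) auto
  have perm: "set (?rc p) = {1..n} \<and> distinct (?rc p)" if "set p = {1..n}" "distinct p" for p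
    using that compl inj by (simp add: distinct_map)
  have invol: "?rc (?rc p) = p" if "set p = {1..n}" for p
    using that by (auto simp: rev_map intro!: map_idI)
  have avoid: "avoids_sep_adj R' (?rc p) \<longleftrightarrow> avoids_adj_sep R p" if "set p = {1..n}" for p
    using that by (intro avoids_adj_sep_rev R) auto
  have "bij_betw ?rc (arrangements (avoids_adj_sep R) {1..n}) (arrangements (avoids_sep_adj R') {1..n})"
  proof (rule bij_betw_byWitness[where f' = ?rc])
    show "?rc ` arrangements (avoids_adj_sep R) {1..n} \<subseteq> arrangements (avoids_sep_adj R') {1..n}"
      using perm avoid by (auto simp: in_arrangements simp del: set_rev set_map distinct_rev)
    show "?rc ` arrangements (avoids_sep_adj R') {1..n} \<subseteq> arrangements (avoids_adj_sep R) {1..n}"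
    proof (rule image_subsetI)
      fix p assume "p \<in> arrangements (avoids_sep_adj R') {1..n}"
      then have p: "set p = {1..n}" "distinct p" "avoids_sep_adj R' p" by (auto simp: in_arrangements)
      then show "?rc p \<in> arrangements (avoids_adj_sep R) {1..n}"
        using perm[OF p(1,2)] avoid[of "?rc p"] invol[OF p(1)]
        unfolding in_arrangements by metis
    qed
  qed (use invol in \<open>auto simp: in_arrangements simp del: rev_map\<close>)
  then show ?thesis by (simp add: Av num_arr_def bij_betw_same_card)
qed

lemma card_Av_123_adj_sep: "card (Av n [1,2,3] Adjacent Separated) = sep_adj123 {1..n}"
  unfolding sep_adj123_def
  by (rule card_Av_adj_sep[OF order_isomorphic_123]) (auto simp: rel_defs)

lemma card_Av_132_adj_sep: "card (Av n [1,3,2] Adjacent Separated) = sep_adj213 {1..n}"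
  unfolding sep_adj213_def
  by (rule card_Av_adj_sep[OF order_isomorphic_132]) (auto simp: rel_defs)

subsection \<open>Superexponential growth for 123\<close>

text \<open>Counts sets \<open>S\<close> of \<open>q\<close> letters in front of the minimum
  together with a choice of the tail. The first sum grants every \<open>S\<close> one tail, empty or
  beginning with the largest available letter. The second grants a further first letter
  \<open>x\<close>, with \<open>j\<close> letters above it, whenever \<open>S\<close> is a proper
  subset of those \<open>j\<close> letters.\<close>

fun lower123 :: "nat \<Rightarrow> nat" where
  "lower123 0 = 1"
| "lower123 (Suc n) = (\<Sum>q\<le>n. (n choose q) * lower123 q) + (\<Sum>j<n. \<Sum>q<j. (j choose q) * lower123 q)"

declare lower123.simps(2) [simp del]

lemma sum_Pow_card:
  fixes f :: "nat \<Rightarrow> nat"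
  assumes "finite B"
  shows "(\<Sum>S\<in>Pow B. f (card S)) = (\<Sum>q\<le>card B. (card B choose q) * f q)"
proof -
  have "(\<Sum>S\<in>Pow B. f (card S)) = (\<Sum>q\<le>card B. \<Sum>S\<in>{S\<in>Pow B. card S = q}. f (card S))"
    using assms by (intro sum.group[symmetric]) (auto intro: card_mono)
  also have "\<dots> = (\<Sum>q\<le>card B. (card B choose q) * f q)"
    using n_subsets[OF assms] by simp
  finally show ?thesis .
qed

lemma sum_psubset_card:
  fixes f :: "nat \<Rightarrow> nat"
  assumes "finite B"
  shows "(\<Sum>S | S \<subset> B. f (card S)) = (\<Sum>q<card B. (card B choose q) * f q)"
proof -
  have "{S. S \<subset> B} = Pow B - {B}" by auto
  then have "(\<Sum>S\<in>Pow B. f (card S)) = f (card B) + (\<Sum>S | S \<subset> B. f (card S))"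
    using assms by (simp add: sum.remove[of "Pow B" B])
  moreover have "(\<Sum>q\<le>card B. (card B choose q) * f q) = (\<Sum>q<card B. (card B choose q) * f q) + f (card B)"
    by (simp add: lessThan_Suc_atMost[symmetric])
  ultimately show ?thesis using sum_Pow_card[OF assms, of f] by simp
qed

text \<open>The largest letter of \<open>R = B - S\<close> may always begin the tail, and so may any
  \<open>x\<close> of \<open>R\<close> below all of \<open>S\<close>. Properness of the inclusion
  leaves a letter of \<open>R\<close> above \<open>x\<close>, so \<open>x\<close> differs from the
  maximum already counted.\<close>

lemma num_arr_desc_tail_ge:
  assumes B: "finite B" "S \<subseteq> B"
  shows "1 + card {x\<in>B. S \<subset> {z\<in>B. x < z}} \<le> num_arr (desc_tail S) (B - S)"
proof (cases "S = B")
  case True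
  then have "{x\<in>B. S \<subset> {z\<in>B. x < z}} = {}" by auto
  then show ?thesis by (simp only: card.empty) (simp add: True)
next
  case False
  define R where "R = B - S"
  have R: "finite R" "R \<noteq> {}" using B False by (auto simp: R_def)
  define Y where "Y = {x\<in>B. S \<subset> {z\<in>B. x < z}}"
  have "Max R \<notin> Y"
  proof
    assume "Max R \<in> Y"
    then obtain z where "z \<in> R" "Max R < z" by (auto simp: Y_def R_def)
    then show False using R by auto
  qed
  moreover have "finite Y" using B by (simp add: Y_def)
  ultimately have "1 + card Y = card (insert (Max R) Y)" by simp
  also have "\<dots> \<le> card {x\<in>R. (\<forall>y\<in>R - {x}. y < x) \<or> (\<forall>a\<in>S. x < a)}"
  proof (rule card_mono)
    have "y < Max R" if "y \<in> R - {Max R}" for y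
      using that Max_ge[OF R(1), of y] by (metis DiffE insertI1 le_neq_implies_less)
    moreover have "Max R \<in> R" using R by simp
    moreover have "x \<in> R \<and> (\<forall>a\<in>S. x < a)" if "x \<in> Y" for x
      using that by (auto simp: Y_def R_def)
    ultimately show "insert (Max R) Y \<subseteq> {x\<in>R. (\<forall>y\<in>R - {x}. y < x) \<or> (\<forall>a\<in>S. x < a)}"
      by blast
  qed (use R in simp)
  finally show ?thesis
    using num_arr_desc_tail[OF R, of S] by (simp add: Y_def R_def)
qed

lemma lower123_le_sep_adj123: "finite A \<Longrightarrow> lower123 (card A) \<le> sep_adj123 A"
proof (induction "card A" arbitrary: A rule: less_induct)
  case less
  show ?case
  proof (cases "A = {}")
    case False
    define B where "B = A - {Min A}"
    have m: "Min A \<in> A" using less.prems False by simp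
    have B: "finite B" "card A = Suc (card B)" "B \<subset> A"
      using less.prems m card_Suc_Diff1[OF less.prems m] unfolding B_def by (simp_all only: finite_Diff) blast
    have IH: "lower123 (card S) \<le> sep_adj123 S" if "S \<subseteq> B" for S
      using that B less by (intro less.hyps psubset_card_mono) (auto intro: finite_subset)
    have "lower123 (card A) = (\<Sum>S\<in>Pow B. lower123 (card S))
        + (\<Sum>x\<in>B. \<Sum>q<card {z\<in>B. x < z}. (card {z\<in>B. x < z} choose q) * lower123 q)"
      unfolding B lower123.simps sum_Pow_card[OF B(1)]
        sum_card_greater[OF B(1), of "\<lambda>j. \<Sum>q<j. (j choose q) * lower123 q"] ..
    also have "(\<Sum>x\<in>B. \<Sum>q<card {z\<in>B. x < z}. (card {z\<in>B. x < z} choose q) * lower123 q)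
        = (\<Sum>x\<in>B. \<Sum>S | S \<subset> {z\<in>B. x < z}. lower123 (card S))"
      using B by (intro sum.cong refl sum_psubset_card[symmetric]) auto
    \<comment> \<open>Extension by zero makes the range of \<open>S\<close> independent of
      \<open>x\<close>; after exchanging the sums, each \<open>S\<close> collects its own choices of
      \<open>x\<close>.\<close>
    also have "\<dots> = (\<Sum>x\<in>B. \<Sum>S\<in>Pow B. if S \<subset> {z\<in>B. x < z} then lower123 (card S) else 0)"
      using B by (intro sum.cong refl sum.mono_neutral_cong_left) auto
    also have "\<dots> = (\<Sum>S\<in>Pow B. \<Sum>x\<in>B. if S \<subset> {z\<in>B. x < z} then lower123 (card S) else 0)"
      by (rule sum.swap)
    also have "\<dots> = (\<Sum>S\<in>Pow B. lower123 (card S) * card {x\<in>B. S \<subset> {z\<in>B. x < z}})"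
      using B by (intro sum.cong refl) (simp add: sum.If_cases Int_def mult.commute)
    also have "(\<Sum>S\<in>Pow B. lower123 (card S)) + \<dots>
        = (\<Sum>S\<in>Pow B. lower123 (card S) * (1 + card {x\<in>B. S \<subset> {z\<in>B. x < z}}))"
      by (simp add: sum.distrib)
    also have "\<dots> \<le> (\<Sum>S\<in>Pow B. sep_adj123 S * num_arr (desc_tail S) (B - S))"
      using B by (intro sum_mono mult_mono IH num_arr_desc_tail_ge) auto
    also have "\<dots> = sep_adj123 A"
      unfolding sep_adj123_rec[OF less.prems False] B_def ..
    finally show ?thesis .
  qed simp
qed

text \<open>In the difference of the definitions at \<open>n + 2\<close> and \<open>n + 1\<close>
  the double sum collapses to its inner sum at \<open>j = n\<close>.\<close>

lemma lower123_rec: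
  "lower123 (n + 2) = 2 * lower123 (n + 1) + n * lower123 n + (\<Sum>q<n. (n + 1 choose q) * lower123 q)"
proof -
  have 1: "lower123 (n + 2) + (\<Sum>q\<le>n. (n choose q) * lower123 q) =
      lower123 (n + 1) + (\<Sum>q\<le>Suc n. (Suc n choose q) * lower123 q) + (\<Sum>q<n. (n choose q) * lower123 q)"
    by (simp add: lower123.simps(2))
  have 2: "(\<Sum>q\<le>n. (n choose q) * lower123 q) = (\<Sum>q<n. (n choose q) * lower123 q) + lower123 n"
    by (simp add: lessThan_Suc_atMost[symmetric])
  have 3: "(\<Sum>q\<le>Suc n. (Suc n choose q) * lower123 q)
      = (\<Sum>q<n. (Suc n choose q) * lower123 q) + Suc n * lower123 n + lower123 (Suc n)"
    by (simp add: lessThan_Suc_atMost[symmetric])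
  show ?thesis using 1 unfolding 2 3 by simp
qed

text \<open>Only the summand \<open>q = n\<close> of the remaining sum is kept. The three-term
  inequality is easy to evaluate, and its growing coefficients still outrun every fixed
  exponential.\<close>

lemma lower123_ge:
  "lower123 (n + 3) \<ge> 2 * lower123 (n + 2) + (n + 1) * lower123 (n + 1) + ((n + 2) * (n + 1) div 2) * lower123 n"
proof -
  have "(n + 2 choose n) * lower123 n \<le> (\<Sum>q<n + 1. (n + 2 choose q) * lower123 q)"
    by (rule member_le_sum[of n "{..<n + 1}" "\<lambda>q. (n + 2 choose q) * lower123 q"]) auto
  moreover have "n + 2 choose n = (n + 2) * (n + 1) div 2"
    using choose_two[of "n + 2"] binomial_symmetric[of 2 "n + 2"] by simp
  moreover have "lower123 (n + 3) = 2 * lower123 (n + 2) + (n + 1) * lower123 (n + 1) +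
      (\<Sum>q<n + 1. (n + 2 choose q) * lower123 q)"
    using lower123_rec[of "n + 1"] by (simp add: eval_nat_numeral)
  ultimately show ?thesis by simp
qed

subsection \<open>Exponential growth for 213\<close>

lemma avoids_sep_adj_append:
  assumes "avoids_sep_adj R (u @ v)"
  shows "avoids_sep_adj R u" "avoids_sep_adj R v"
proof -
  show "avoids_sep_adj R u"
    unfolding avoids_sep_adj_def
  proof (intro allI impI)
    fix i j assume "i + 2 \<le> j" "Suc j < length u"
    then show "\<not> R (u ! i) (u ! j) (u ! Suc j)"
      using avoids_sep_adjD[OF assms, of i j] by (simp add: nth_append)
  qed
  show "avoids_sep_adj R v"
    unfolding avoids_sep_adj_def
  proof (intro allI impI)
    fix i j assume "i + 2 \<le> j" "Suc j < length v"
    then show "\<not> R (v ! i) (v ! j) (v ! Suc j)"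
      using avoids_sep_adjD[OF assms, of "length u + i" "length u + j"]
        nth_append_length_plus[of u v "Suc j"] by simp
  qed
qed

text \<open>Getting from below \<open>a\<close> to above it takes an ascent across \<open>a\<close>
  at adjacent positions, so a word starting below stays there.\<close>

lemma no_crossing_ascent_below:
  fixes a :: nat
  assumes "\<And>j. Suc j < length \<tau> \<Longrightarrow> \<not> (\<tau> ! j < a \<and> a < \<tau> ! Suc j)" "a \<notin> set \<tau>"
    and "\<tau> \<noteq> []" "hd \<tau> < a" "x \<in> set \<tau>"
  shows "x < a"
proof -
  have "k < length \<tau> \<Longrightarrow> \<tau> ! k < a" for k
  proof (induction k)
    case 0
    then show ?case using assms by (simp add: hd_conv_nth)
  next
    case (Suc k)
    then have "\<not> a < \<tau> ! Suc k" "\<tau> ! Suc k \<noteq> a"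
      using assms(1)[of k] assms(2) by auto
    then show ?case by simp
  qed
  then show ?thesis using assms(5) by (metis in_set_conv_nth)
qed

text \<open>Only necessary conditions are drawn, as an upper bound is the aim. For the third:
  \<open>a\<close> is separated from \<open>m\<close>, so \<open>a\<close>, \<open>m\<close>,
  \<open>hd \<tau>\<close> would be an occurrence unless \<open>hd \<tau>\<close> lies below
  \<open>a\<close>; no ascent of \<open>\<tau>\<close> crosses \<open>a\<close>, hence all of
  \<open>\<tau>\<close> stays below.\<close>

lemma avoids_sep_adj_213_min:
  assumes m: "\<forall>x\<in>set \<sigma> \<union> set \<tau>. m < x" and dist: "distinct \<sigma>" "distinct \<tau>" "set \<sigma> \<inter> set \<tau> = {}"
    and avoid: "avoids_sep_adj rel213 (\<sigma> @ m # \<tau>)"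
  shows "avoids_sep_adj rel213 \<sigma>" "avoids_sep_adj rel213 \<tau>"
    and "\<lbrakk>a \<in> set (butlast \<sigma>); x \<in> set \<tau>\<rbrakk> \<Longrightarrow> x < a"
    and "\<lbrakk>a \<in> set \<sigma>; Suc j < length \<tau>\<rbrakk> \<Longrightarrow> \<not> (\<tau> ! j < a \<and> a < \<tau> ! Suc j)"
proof -
  have *: "avoids_sep_adj rel213 \<sigma> \<and> avoids_sep_adj rel213 \<tau> \<and>
    (\<forall>a\<in>set (butlast \<sigma>). \<tau> \<noteq> [] \<longrightarrow> \<not> rel213 a m (hd \<tau>)) \<and>
    (\<forall>j. Suc j < length \<tau> \<longrightarrow> (\<forall>a\<in>set \<sigma>. \<not> rel213 a (\<tau> ! j) (\<tau> ! Suc j))) \<and>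
    (\<forall>j. 1 \<le> j \<longrightarrow> Suc j < length \<tau> \<longrightarrow> \<not> rel213 m (\<tau> ! j) (\<tau> ! Suc j))"
  proof -
    have "\<not> rel213 a b m" if "a \<in> set \<sigma>" for a b
      using m that by (simp add: rel_defs not_less less_imp_le)
    then show ?thesis
      using avoid avoids_sep_adj_split[of \<sigma> rel213 m \<tau>] by blast
  qed
  then show "avoids_sep_adj rel213 \<sigma>" "avoids_sep_adj rel213 \<tau>" by auto
  show cross: "\<not> (\<tau> ! j < a \<and> a < \<tau> ! Suc j)" if "a \<in> set \<sigma>" "Suc j < length \<tau>" for a j
    using * that by (auto simp: rel_defs)
  show "x < a" if "a \<in> set (butlast \<sigma>)" "x \<in> set \<tau>"
  proof -
    have a: "a \<in> set \<sigma>" using that by (auto dest: in_set_butlastD)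
    have "\<tau> \<noteq> []" using that by auto
    then have "\<not> rel213 a m (hd \<tau>)" "hd \<tau> \<in> set \<tau>" using * that by auto
    then have "hd \<tau> < a" using m dist a by (auto simp: rel_defs not_less le_less)
    then show ?thesis
      using no_crossing_ascent_below[of \<tau> a x] cross[OF a] dist a \<open>\<tau> \<noteq> []\<close> that by blast
  qed
qed

text \<open>Only descents can cross the level \<open>y\<close>, so it is crossed at most once,
  downwards.\<close>

lemma split_at_level:
  assumes cross: "\<And>j. Suc j < length \<tau> \<Longrightarrow> \<not> (\<tau> ! j < y \<and> y < \<tau> ! Suc j)" and "y \<notin> set \<tau>"
  obtains hi lo where "\<tau> = hi @ lo" "\<forall>x\<in>set hi. y < x" "\<forall>x\<in>set lo. x < (y :: nat)"
proof
  let ?hi = "takeWhile ((<) y) \<tau>" and ?lo = "dropWhile ((<) y) \<tau>"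
  show "\<tau> = ?hi @ ?lo" by simp
  show "\<forall>x\<in>set ?hi. y < x" by (auto dest: set_takeWhileD)
  show "\<forall>x\<in>set ?lo. x < y"
  proof
    fix x assume x: "x \<in> set ?lo"
    then have ne: "?lo \<noteq> []" by (metis empty_iff empty_set)
    then have "\<not> y < hd ?lo" by (rule hd_dropWhile)
    moreover have "hd ?lo \<in> set \<tau>" using ne by (meson hd_in_set set_dropWhileD)
    ultimately have "hd ?lo < y" using assms(2) by (metis linorder_neqE_nat)
    moreover have "\<not> (?lo ! j < y \<and> y < ?lo ! Suc j)" if "Suc j < length ?lo" for j
    proof -
      let ?k = "length ?hi"
      have "\<tau> ! (?k + i) = ?lo ! i" for i
        by (metis nth_append_length_plus takeWhile_dropWhile_id)
      from this[of j] this[of "Suc j"] cross[of "?k + j"] that show ?thesis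
        by (metis add_Suc_right length_append nat_add_left_cancel_less takeWhile_dropWhile_id)
    qed
    moreover have "y \<notin> set ?lo" using assms(2) by (meson set_dropWhileD)
    ultimately show "x < y" using no_crossing_ascent_below[of ?lo y x] ne x by blast
  qed
qed

text \<open>The top segments of \<open>B\<close>. There is at most one of each size, so sums over
  them become sums over sizes without binomial coefficients.\<close>

definition upper_sets :: "nat set \<Rightarrow> nat set set" where
  "upper_sets B = {S. S \<subseteq> B \<and> (\<forall>x\<in>S. \<forall>y\<in>B - S. y < x)}"

lemma finite_upper_sets [simp]: "finite B \<Longrightarrow> finite (upper_sets B)"
  by (rule finite_subset[of _ "Pow B"]) (auto simp: upper_sets_def)

text \<open>Top segments form a chain: letters in the two differences would each have to exceed the
  other.\<close>

lemma inj_on_card_upper_sets: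
  assumes "finite B"
  shows "inj_on card (upper_sets B)"
proof (rule inj_onI)
  fix S T assume *: "S \<in> upper_sets B" "T \<in> upper_sets B" "card S = card T"
  have "finite S" "finite T" using * assms by (auto simp: upper_sets_def intro: finite_subset)
  moreover have "S \<subseteq> T \<or> T \<subseteq> S"
  proof (rule ccontr)
    assume "\<not> (S \<subseteq> T \<or> T \<subseteq> S)"
    then obtain x y where "x \<in> S - T" "y \<in> T - S" by blast
    then have "x < y" "y < x" using * unfolding upper_sets_def by blast+
    then show False by linarith
  qed
  ultimately show "S = T" using *(3) card_subset_eq by metis
qed

lemma sum_upper_sets_le:
  fixes f :: "nat \<Rightarrow> nat"
  assumes "finite B"
  shows "(\<Sum>S\<in>upper_sets B. f (card S)) \<le> (\<Sum>i\<le>card B. f i)"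
proof -
  have "(\<Sum>S\<in>upper_sets B. f (card S)) = sum f (card ` upper_sets B)"
    using inj_on_card_upper_sets[OF assms] by (simp add: sum.reindex)
  also have "\<dots> \<le> (\<Sum>i\<le>card B. f i)"
    using assms by (intro sum_mono2) (auto simp: upper_sets_def intro: card_mono)
  finally show ?thesis .
qed

text \<open>Here \<open>i\<close> is the size of the top segment in front of the minimum. The first
  product treats all other letters as one tail. In the second one letter \<open>y\<close> stands
  next to the minimum, and the tail splits into \<open>j\<close> letters above \<open>y\<close> and
  \<open>n - i - 1 - j\<close> below. The range of \<open>j\<close> starts at 1 because an empty
  upper part falls under the first product.\<close>

fun upper213 :: "nat \<Rightarrow> nat" where
  "upper213 0 = 1"
| "upper213 (Suc n) =
    (\<Sum>i\<le>n. upper213 i * (upper213 (n - i) + (\<Sum>j\<in>{1..<n - i}. upper213 j * upper213 (n - i - 1 - j))))"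

declare upper213.simps(2) [simp del]

definition upper213_aux :: "nat \<Rightarrow> nat" where
  "upper213_aux m = upper213 m + (\<Sum>j\<in>{1..<m}. upper213 j * upper213 (m - 1 - j))"

lemma upper213_Suc: "upper213 (Suc n) = (\<Sum>i\<le>n. upper213 i * upper213_aux (n - i))"
  by (simp add: upper213.simps upper213_aux_def)

text \<open>Either everything in front of the minimum exceeds everything behind it, or only the letter
  \<open>y\<close> next to the minimum fails to do so; no ascent of the final segment crosses the level \<open>y\<close>,
  so that segment consists of a part above \<open>y\<close> followed by a part below \<open>y\<close>.\<close>

lemma arrangements_213_subset:
  fixes A :: "nat set"
  assumes A: "finite A" "A \<noteq> {}"
  defines "m \<equiv> Min A" and "B \<equiv> A - {Min A}"
  defines "V \<equiv> arrangements (avoids_sep_adj rel213)"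
  shows "V A \<subseteq> (\<Union>S\<in>upper_sets B. (\<lambda>(\<sigma>, \<tau>). \<sigma> @ m # \<tau>) ` (V S \<times> V (B - S))) \<union>
    (\<Union>S\<in>upper_sets B. \<Union>H\<in>{H\<in>upper_sets (B - S). H \<noteq> {} \<and> H \<noteq> B - S}.
      (\<lambda>(\<sigma>, hi, lo). \<sigma> @ Max (B - S - H) # m # hi @ lo) ` (V S \<times> V H \<times> V (B - S - H - {Max (B - S - H)})))"
    (is "_ \<subseteq> ?Quad \<union> ?Cubic")
proof
  fix p assume p: "p \<in> V A"
  have "m \<in> set p" using p A by (simp add: in_arrangements V_def m_def)
  then obtain \<sigma> \<tau> where s: "p = \<sigma> @ m # \<tau>" by (meson split_list)
  with p have d: "distinct \<sigma>" "distinct \<tau>" "set \<sigma> \<inter> set \<tau> = {}" "set \<sigma> \<union> set \<tau> = B"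
    and av: "avoids_sep_adj rel213 (\<sigma> @ m # \<tau>)"
    by (auto simp: in_arrangements V_def B_def m_def)
  have mm: "\<forall>x\<in>set \<sigma> \<union> set \<tau>. m < x"
    using Min_less_split[OF A(1)] d(4) by (simp add: m_def B_def)
  note 213 = avoids_sep_adj_213_min[OF mm d(1-3) av]
  show "p \<in> ?Quad \<union> ?Cubic"
  proof (cases "\<forall>a\<in>set \<sigma>. \<forall>x\<in>set \<tau>. x < a")
    case True
    have BS: "B - set \<sigma> = set \<tau>" using d by auto
    have "set \<sigma> \<in> upper_sets B" using True d(4) BS by (auto simp: upper_sets_def)
    moreover have "\<sigma> \<in> V (set \<sigma>)" "\<tau> \<in> V (B - set \<sigma>)"
      unfolding BS using 213 d by (auto simp: V_def in_arrangements)
    ultimately have "p \<in> ?Quad" unfolding s by force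
    then show ?thesis by blast
  next
    case False
    then obtain a x where ax: "a \<in> set \<sigma>" "x \<in> set \<tau>" "\<not> x < a" by blast
    then have "\<sigma> \<noteq> []" by auto
    then obtain \<sigma>' y where \<sigma>: "\<sigma> = \<sigma>' @ [y]" by (cases \<sigma> rule: rev_cases) auto
    have above: "z < b" if "b \<in> set \<sigma>'" "z \<in> set \<tau>" for b z
      using 213(3)[of b z] that \<sigma> by simp
    have "a = y" using above ax \<sigma> by auto
    then have yx: "y < x" using ax d \<sigma> by (metis IntI empty_iff linorder_neqE_nat)
    have y\<tau>: "y \<notin> set \<tau>" using d \<sigma> by auto
    obtain hi lo where \<tau>: "\<tau> = hi @ lo" and hi: "\<forall>x\<in>set hi. y < x" and lo: "\<forall>x\<in>set lo. x < y"
      using split_at_level[of \<tau> y] 213(4)[of y] \<sigma> y\<tau> by auto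
    have xhi: "x \<in> set hi" using ax \<tau> lo yx by auto
    have BS: "B - set \<sigma>' = insert y (set hi \<union> set lo)" using d \<sigma> \<tau> by auto
    have BSH: "B - set \<sigma>' - set hi = insert y (set lo)" using d \<sigma> \<tau> by auto
    have Max: "Max (B - set \<sigma>' - set hi) = y"
      unfolding BSH by (rule Max_eqI) (use lo in \<open>auto intro: less_imp_le\<close>)
    have L: "B - set \<sigma>' - set hi - {Max (B - set \<sigma>' - set hi)} = set lo"
      unfolding Max unfolding BSH using y\<tau> \<tau> by auto
    have "z < b" if "b \<in> set \<sigma>'" "z \<in> insert y (set hi \<union> set lo)" for b z
      using that above[OF that(1)] yx ax(2) \<tau> less_trans by fastforce
    moreover have "set \<sigma>' \<subseteq> B" using d(4) \<sigma> by auto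
    ultimately have up\<sigma>: "set \<sigma>' \<in> upper_sets B"
      unfolding upper_sets_def by (simp add: BS)
    have "set hi \<in> upper_sets (B - set \<sigma>')"
      using hi lo BS less_trans unfolding upper_sets_def BSH by fastforce
    moreover have "y \<notin> set hi" using hi by auto
    with xhi have "set hi \<noteq> {}" "set hi \<noteq> B - set \<sigma>'" unfolding BS by auto
    ultimately have uphi: "set hi \<in> {H\<in>upper_sets (B - set \<sigma>'). H \<noteq> {} \<and> H \<noteq> B - set \<sigma>'}"
      by blast
    have "\<sigma>' \<in> V (set \<sigma>')" "hi \<in> V (set hi)" "lo \<in> V (set lo)"
      using 213(1,2) d avoids_sep_adj_append[of rel213 \<sigma>' "[y]"] avoids_sep_adj_append[of rel213 hi lo]
      by (simp_all add: V_def in_arrangements \<sigma> \<tau>)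
    then have pin: "p \<in> (\<lambda>(\<sigma>, u, v). \<sigma> @ Max (B - set \<sigma>' - set hi) # m # u @ v) `
        (V (set \<sigma>') \<times> V (set hi) \<times> V (B - set \<sigma>' - set hi - {Max (B - set \<sigma>' - set hi)}))"
      by (intro image_eqI[where x = "(\<sigma>', hi, lo)"]) (simp_all only: L mem_Sigma_iff, simp add: Max s \<sigma> \<tau>)
    have "p \<in> ?Cubic" by (rule UN_I[OF up\<sigma>]) (rule UN_I[OF uphi], rule pin)
    then show ?thesis by (rule UnI2)
  qed
qed

lemma sep_adj213_le_upper213: "finite A \<Longrightarrow> sep_adj213 A \<le> upper213 (card A)"
proof (induction "card A" arbitrary: A rule: less_induct)
  case less
  show ?case
  proof (cases "A = {}")
    case False
    define B where "B = A - {Min A}"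
    have m: "Min A \<in> A" using less.prems False by simp
    have B: "finite B" "card A = Suc (card B)" "B \<subset> A"
      using less.prems m card_Suc_Diff1[OF less.prems m] unfolding B_def by (simp_all only: finite_Diff) blast
    define V where "V = arrangements (avoids_sep_adj rel213)"
    have V: "card (V S) \<le> upper213 (card S)" "finite (V S)" if "S \<subseteq> B" for S
    proof -
      have "finite S" using that B finite_subset by blast
      moreover have "card S < card A" using that B less.prems by (meson psubset_card_mono subset_psubset_trans)
      ultimately show "card (V S) \<le> upper213 (card S)" "finite (V S)"
        using less.hyps[of S] by (auto simp: V_def sep_adj213_def num_arr_def)
    qed
    let ?I = "\<lambda>S. {H\<in>upper_sets (B - S). H \<noteq> {} \<and> H \<noteq> B - S}"
    let ?Q = "\<lambda>S. (\<lambda>(\<sigma>, \<tau>). \<sigma> @ Min A # \<tau>) ` (V S \<times> V (B - S))"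
    let ?C = "\<lambda>S H. (\<lambda>(\<sigma>, hi, lo). \<sigma> @ Max (B - S - H) # Min A # hi @ lo) ` (V S \<times> V H \<times> V (B - S - H - {Max (B - S - H)}))"
    let ?u = "\<lambda>n i. upper213 i * upper213 (n - i)"
    \<comment> \<open>Vanishing outside the possible sizes of a nonempty proper \<open>H\<close>
      allows the sum to be extended to all upper sets, and then to all sizes.\<close>
    let ?c = "\<lambda>n j. if 1 \<le> j \<and> j < n then upper213 j * upper213 (n - 1 - j) else 0"
    have Q: "card (?Q S) \<le> upper213 (card S) * upper213 (card B - card S)" and finQ: "finite (?Q S)"
      if "S \<in> upper_sets B" for S
    proof -
      have S: "S \<subseteq> B" using that by (simp add: upper_sets_def)
      then have "card (B - S) = card B - card S" using B by (simp add: card_Diff_subset finite_subset)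
      then show "card (?Q S) \<le> upper213 (card S) * upper213 (card B - card S)"
        using V[of S] V[of "B - S"] S
        by (intro order.trans[OF card_image_le]) (auto simp: card_cartesian_product intro!: mult_mono)
      show "finite (?Q S)" using V[of S] V[of "B - S"] S by auto
    qed
    have C: "card (?C S H) \<le> upper213 (card S) * ?c (card B - card S) (card H)" and finC: "finite (?C S H)"
      if "S \<in> upper_sets B" "H \<in> ?I S" for S H
    proof -
      have S: "S \<subseteq> B" and H: "H \<subseteq> B - S" "H \<noteq> {}" "H \<noteq> B - S" using that by (auto simp: upper_sets_def)
      have fin: "finite (B - S)" "finite H" "finite (B - S - H)" using B H finite_subset by auto
      have cS: "card (B - S) = card B - card S" using B S by (simp add: card_Diff_subset finite_subset)
      have cH: "0 < card H" "card H < card (B - S)"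
        using fin H by (auto simp: card_gt_0_iff intro: psubset_card_mono)
      let ?L = "B - S - H - {Max (B - S - H)}"
      have "Max (B - S - H) \<in> B - S - H" using fin H by (intro Max_in) auto
      then have "card ?L = card (B - S) - 1 - card H"
        using fin H by (simp add: card_Diff_subset)
      then have le: "card (V S \<times> V H \<times> V ?L) \<le> upper213 (card S) * ?c (card B - card S) (card H)"
        using V[of S] V[of H] V[of ?L] S H cH cS by (auto simp: card_cartesian_product intro!: mult_mono)
      have fin': "finite (V S \<times> V H \<times> V ?L)"
        using V[of S] V[of H] V[of ?L] S H by auto
      show "card (?C S H) \<le> upper213 (card S) * ?c (card B - card S) (card H)"
        by (rule order.trans[OF card_image_le[OF fin'] le])
      show "finite (?C S H)" using fin' by (rule finite_imageI)
    qed
    have finI: "finite (?I S)" for S using B by simp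
    have "sep_adj213 A = card (V A)" by (simp add: sep_adj213_def num_arr_def V_def)
    also have "\<dots> \<le> card ((\<Union>S\<in>upper_sets B. ?Q S) \<union> (\<Union>S\<in>upper_sets B. \<Union>H\<in>?I S. ?C S H))"
    proof (rule card_mono)
      show "V A \<subseteq> (\<Union>S\<in>upper_sets B. ?Q S) \<union> (\<Union>S\<in>upper_sets B. \<Union>H\<in>?I S. ?C S H)"
        using arrangements_213_subset[OF less.prems False] unfolding V_def B_def .
    qed (use B finQ finC finI in \<open>auto simp del: finite_imageI\<close>)
    also have "\<dots> \<le> (\<Sum>S\<in>upper_sets B. card (?Q S)) + (\<Sum>S\<in>upper_sets B. \<Sum>H\<in>?I S. card (?C S H))"
      using B finI by (intro order.trans[OF card_Un_le] add_mono order.trans[OF card_UN_le] sum_mono card_UN_le order.refl) auto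
    also have "\<dots> \<le> (\<Sum>S\<in>upper_sets B. upper213 (card S) * upper213 (card B - card S)) +
        (\<Sum>S\<in>upper_sets B. \<Sum>H\<in>?I S. upper213 (card S) * ?c (card B - card S) (card H))"
      by (intro add_mono sum_mono Q C)
    also have "(\<Sum>S\<in>upper_sets B. \<Sum>H\<in>?I S. upper213 (card S) * ?c (card B - card S) (card H)) \<le>
       (\<Sum>S\<in>upper_sets B. upper213 (card S) * (\<Sum>j\<in>{1..<card B - card S}. upper213 j * upper213 (card B - card S - 1 - j)))"
    proof (rule sum_mono)
      fix S assume "S \<in> upper_sets B"
      then have "S \<subseteq> B" by (simp add: upper_sets_def)
      then have cS: "card (B - S) = card B - card S" using B by (simp add: card_Diff_subset finite_subset)
      let ?n = "card B - card S"
      have "(\<Sum>H\<in>?I S. ?c ?n (card H)) \<le> (\<Sum>H\<in>upper_sets (B - S). ?c ?n (card H))"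
        using B by (intro sum_mono2) auto
      also have "\<dots> \<le> (\<Sum>j\<le>?n. ?c ?n j)"
        using sum_upper_sets_le[of "B - S" "?c ?n"] B unfolding cS by simp
      also have "\<dots> = (\<Sum>j\<in>{1..<?n}. upper213 j * upper213 (?n - 1 - j))"
        by (rule sum.mono_neutral_cong_right) auto
      finally show "(\<Sum>H\<in>?I S. upper213 (card S) * ?c ?n (card H)) \<le>
          upper213 (card S) * (\<Sum>j\<in>{1..<?n}. upper213 j * upper213 (?n - 1 - j))"
        by (simp only: sum_distrib_left[symmetric] mult_le_mono2)
    qed
    also have "(\<Sum>S\<in>upper_sets B. upper213 (card S) * upper213 (card B - card S)) + \<dots> =
        (\<Sum>S\<in>upper_sets B. upper213 (card S) * upper213_aux (card B - card S))"
      by (simp add: upper213_aux_def sum.distrib[symmetric] distrib_left)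
    also have "\<dots> \<le> (\<Sum>i\<le>card B. upper213 i * upper213_aux (card B - i))"
      by (rule sum_upper_sets_le[OF B(1)])
    finally show ?thesis by (simp add: B upper213_Suc)
  qed simp
qed

text \<open>The triangle \<open>i + j \<le> N\<close> lies inside the square. This lets the
  generating function argument run on partial sums, where convergence is not an issue.\<close>

lemma sum_convolution_le:
  fixes a b :: "nat \<Rightarrow> real"
  assumes "\<And>i. a i \<ge> 0" "\<And>i. b i \<ge> 0"
  shows "(\<Sum>n\<le>N. \<Sum>i\<le>n. a i * b (n - i)) \<le> (\<Sum>i\<le>N. a i) * (\<Sum>i\<le>N. b i)"
proof -
  have "(\<Sum>n\<le>N. \<Sum>i\<le>n. a i * b (n - i)) = (\<Sum>(i, j)\<in>{(i, j). i + j \<le> N}. a i * b j)"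
    by (rule sum.triangle_reindex_eq[symmetric])
  also have "\<dots> \<le> (\<Sum>(i, j)\<in>{..N} \<times> {..N}. a i * b j)"
    using assms by (intro sum_mono2) auto
  also have "\<dots> = (\<Sum>i\<le>N. a i) * (\<Sum>i\<le>N. b i)"
    by (simp add: sum_product sum.cartesian_product)
  finally show ?thesis .
qed

text \<open>The generating function \<open>E\<close> of \<^const>\<open>upper213\<close> satisfies \<open>E = 1 + x E (E + x E (E - 1))\<close>, and
  at \<open>x = 1/5\<close> the right-hand side maps \<open>[1, 3/2]\<close> into itself.\<close>

lemma upper213_partial_sum: "(\<Sum>n\<le>N. upper213 n / 5 ^ n) \<le> (3 / 2 :: real)"
proof (induction N)
  case (Suc N)
  define u where "u n = upper213 n / (5 :: real) ^ n" for n
  define v where "v n = upper213_aux n / (5 :: real) ^ n" for n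
  \<comment> \<open>The terms of \<open>E - 1\<close> at \<open>x = 1/5\<close>; \<open>v\<close>
    gives those of the factor \<open>E + x E (E - 1)\<close>.\<close>
  define u' where "u' n = (if n = 0 then 0 else u n)" for n
  define s where "s = (\<Sum>n\<le>N. u n)"
  have nonneg: "u n \<ge> 0" "v n \<ge> 0" "u' n \<ge> 0" for n by (auto simp: u_def v_def u'_def)
  have s: "s \<le> 3 / 2" using Suc.IH by (simp add: s_def u_def)
  have "s \<ge> u 0" unfolding s_def using nonneg by (intro member_le_sum) auto
  then have s1: "s \<ge> 1" by (simp add: u_def)
  have v_Suc: "v (Suc n) = u (Suc n) + (\<Sum>i\<le>n. u' i * u (n - i)) / 5" for n
  proof -
    have "(\<Sum>i\<le>n. u' i * u (n - i)) = (\<Sum>i\<in>{1..<Suc n}. u i * u (n - i))"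
      by (rule sum.mono_neutral_cong_right) (auto simp: u'_def)
    also have "\<dots> = (\<Sum>i\<in>{1..<Suc n}. upper213 i * upper213 (n - i)) / 5 ^ n"
      unfolding of_nat_sum sum_divide_distrib
      by (rule sum.cong) (auto simp: u_def power_add[symmetric])
    finally show ?thesis by (simp add: v_def u_def upper213_aux_def add_divide_distrib)
  qed
  have "(\<Sum>n\<le>N. v n) \<le> s + s * (s - 1) / 5"
  proof (cases N)
    case 0
    then show ?thesis using s1 by (simp add: s_def v_def u_def upper213_aux_def)
  next
    case (Suc M)
    have "(\<Sum>n\<le>N. v n) = v 0 + (\<Sum>n\<le>M. v (Suc n))"
      unfolding Suc by (rule sum.atMost_Suc_shift)
    also have "\<dots> = u 0 + (\<Sum>n\<le>M. u (Suc n)) + (\<Sum>n\<le>M. \<Sum>i\<le>n. u' i * u (n - i)) / 5"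
      by (simp add: v_Suc sum.distrib sum_divide_distrib v_def[of 0] u_def[of 0] upper213_aux_def)
    also have "u 0 + (\<Sum>n\<le>M. u (Suc n)) = s"
      unfolding s_def Suc by (rule sum.atMost_Suc_shift[symmetric])
    also have "(\<Sum>n\<le>M. \<Sum>i\<le>n. u' i * u (n - i)) \<le> (\<Sum>i\<le>M. u' i) * (\<Sum>i\<le>M. u i)"
      by (rule sum_convolution_le) (use nonneg in auto)
    also have "\<dots> \<le> (\<Sum>i\<le>N. u' i) * (\<Sum>i\<le>N. u i)"
      using nonneg by (intro mult_mono sum_mono2 sum_nonneg) (auto simp: Suc)
    also have "(\<Sum>i\<le>N. u' i) = s - 1"
      unfolding s_def Suc sum.atMost_Suc_shift by (simp add: u'_def u_def)
    finally show ?thesis by (simp add: s_def mult.commute)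
  qed
  then have "s * (\<Sum>n\<le>N. v n) \<le> s * (s + s * (s - 1) / 5)"
    using s1 by (intro mult_left_mono) auto
  \<comment> \<open>The right-hand side is 2.475. The rounded bound 5/2 is just what closes the
    induction, as \<open>1 + (5/2) / 5 = 3/2\<close>.\<close>
  also have "\<dots> \<le> 3 / 2 * (3 / 2 + 3 / 2 * (3 / 2 - 1) / 5)"
    using s s1 by (intro mult_mono add_mono divide_right_mono) auto
  finally have bound: "s * (\<Sum>n\<le>N. v n) \<le> 5 / 2" by simp
  have "(\<Sum>n\<le>Suc N. u n) = u 0 + (\<Sum>n\<le>N. u (Suc n))"
    by (rule sum.atMost_Suc_shift)
  also have "\<dots> = 1 + (\<Sum>n\<le>N. \<Sum>i\<le>n. u i * v (n - i)) / 5"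
  proof -
    have "u (Suc n) = (\<Sum>i\<le>n. u i * v (n - i)) / 5" for n
      unfolding u_def v_def upper213_Suc of_nat_sum sum_divide_distrib
      by (rule sum.cong) (auto simp: power_add[symmetric])
    then show ?thesis by (simp add: u_def[of 0] sum_divide_distrib)
  qed
  also have "(\<Sum>n\<le>N. \<Sum>i\<le>n. u i * v (n - i)) \<le> s * (\<Sum>n\<le>N. v n)"
    unfolding s_def by (rule sum_convolution_le) (use nonneg in auto)
  finally show ?case using bound by (simp add: u_def)
qed simp

lemma upper213_le: "2 * upper213 n \<le> 3 * 5 ^ n"
proof -
  have "upper213 n / 5 ^ n \<le> (\<Sum>n\<le>n. upper213 n / (5 :: real) ^ n)"
    by (rule member_le_sum) auto
  also have "\<dots> \<le> 3 / 2" by (rule upper213_partial_sum)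
  finally have "real (2 * upper213 n) \<le> real (3 * 5 ^ n)" by (simp add: field_simps)
  then show ?thesis by (simp only: of_nat_le_iff)
qed

section \<open>Numerical comparison of the two bounds\<close>

lemma lower123_values:
  shows "6 \<le> lower123 3" and "19 \<le> lower123 4" and "68 \<le> lower123 5"
   and "272 \<le> lower123 6" and "1169 \<le> lower123 7" and "5398 \<le> lower123 8"
   and "26595 \<le> lower123 9" and "138458 \<le> lower123 10" and "759181 \<le> lower123 11"
   and "4365667 \<le> lower123 12" and "26220553 \<le> lower123 13" and "164045228 \<le> lower123 14"
   and "1066233342 \<le> lower123 15" and "7182257941 \<le> lower123 16" and "50043443372 \<le> lower123 17"
   and "360010748312 \<le> lower123 18" and "2669645498921 \<le> lower123 19" and "20376913284070 \<le> lower123 20"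
   and "159879133226919 \<le> lower123 21" and "1287922086908648 \<le> lower123 22" and "10640372940202765 \<le> lower123 23"
   and "90064452498806293 \<le> lower123 24" and "780323978609063029 \<le> lower123 25" and "6914306699250306590 \<le> lower123 26"
  
proof -
  \<comment> \<open>These exact values seed \<open>lower123_ge\<close>; each later bound is what it
    yields from the three preceding ones. The list runs to 26 because 24, 25 and 26 are the base
    cases for the comparison with powers of 5.\<close>
  have v0: "lower123 0 = 1" and v1: "lower123 1 = 1" and v2: "lower123 2 = 2"
    by (simp_all add: lower123.simps(2) numeral_2_eq_2)
  show v3: "6 \<le> lower123 3" using lower123_ge[of 0] v0 v1 v2 by (simp del: add_2_eq_Suc' One_nat_def)
  show v4: "19 \<le> lower123 4" using lower123_ge[of 1] v1 v2 v3 by (simp del: add_2_eq_Suc' One_nat_def)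
  show v5: "68 \<le> lower123 5" using lower123_ge[of 2] v2 v3 v4 by simp
  show v6: "272 \<le> lower123 6" using lower123_ge[of 3] v3 v4 v5 by simp
  show v7: "1169 \<le> lower123 7" using lower123_ge[of 4] v4 v5 v6 by simp
  show v8: "5398 \<le> lower123 8" using lower123_ge[of 5] v5 v6 v7 by simp
  show v9: "26595 \<le> lower123 9" using lower123_ge[of 6] v6 v7 v8 by simp
  show v10: "138458 \<le> lower123 10" using lower123_ge[of 7] v7 v8 v9 by simp
  show v11: "759181 \<le> lower123 11" using lower123_ge[of 8] v8 v9 v10 by simp
  show v12: "4365667 \<le> lower123 12" using lower123_ge[of 9] v9 v10 v11 by simp
  show v13: "26220553 \<le> lower123 13" using lower123_ge[of 10] v10 v11 v12 by simp
  show v14: "164045228 \<le> lower123 14" using lower123_ge[of 11] v11 v12 v13 by simp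
  show v15: "1066233342 \<le> lower123 15" using lower123_ge[of 12] v12 v13 v14 by simp
  show v16: "7182257941 \<le> lower123 16" using lower123_ge[of 13] v13 v14 v15 by simp
  show v17: "50043443372 \<le> lower123 17" using lower123_ge[of 14] v14 v15 v16 by simp
  show v18: "360010748312 \<le> lower123 18" using lower123_ge[of 15] v15 v16 v17 by simp
  show v19: "2669645498921 \<le> lower123 19" using lower123_ge[of 16] v16 v17 v18 by simp
  show v20: "20376913284070 \<le> lower123 20" using lower123_ge[of 17] v17 v18 v19 by simp
  show v21: "159879133226919 \<le> lower123 21" using lower123_ge[of 18] v18 v19 v20 by simp
  show v22: "1287922086908648 \<le> lower123 22" using lower123_ge[of 19] v19 v20 v21 by simp
  show v23: "10640372940202765 \<le> lower123 23" using lower123_ge[of 20] v20 v21 v22 by simp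
  show v24: "90064452498806293 \<le> lower123 24" using lower123_ge[of 21] v21 v22 v23 by simp
  show v25: "780323978609063029 \<le> lower123 25" using lower123_ge[of 22] v22 v23 v24 by simp
  show v26: "6914306699250306590 \<le> lower123 26" using lower123_ge[of 23] v23 v24 v25 by simp
qed

lemma upper213_values:
  shows "upper213 6 = 264" and "upper213 7 = 1015" and "upper213 8 = 4002"
   and "upper213 9 = 16094" and "upper213 10 = 65758" and "upper213 11 = 272208"
   and "upper213 12 = 1139182" and "upper213 13 = 4811807" and "upper213 14 = 20487096"
   and "upper213 15 = 87832558" and "upper213 16 = 378846620" and "upper213 17 = 1642851797"
   and "upper213 18 = 7158220968" and "upper213 19 = 31323340342" and "upper213 20 = 137595355130"
   and "upper213 21 = 606533278416" and "upper213 22 = 2682157911032" and "upper213 23 = 11895267124841"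
  
proof -
  \<comment> \<open>\<open>upper213\<close> and \<open>upper213_aux\<close> are evaluated in turn,
    each value becoming a rewrite rule, so that every step is a single convolution of known
    numbers.\<close>
  have rec: "upper213 (numeral k) = (\<Sum>i<numeral k. upper213 i * upper213_aux (pred_numeral k - i))"
    "upper213_aux (numeral k) = upper213 (numeral k) +
      (\<Sum>j<pred_numeral k. upper213 (Suc j) * upper213 (pred_numeral k - Suc j))" for k
  proof -
    show "upper213 (numeral k) = (\<Sum>i<numeral k. upper213 i * upper213_aux (pred_numeral k - i))"
      by (simp add: numeral_eq_Suc upper213_Suc lessThan_Suc_atMost)
    show "upper213_aux (numeral k) = upper213 (numeral k) +
      (\<Sum>j<pred_numeral k. upper213 (Suc j) * upper213 (pred_numeral k - Suc j))"
      unfolding upper213_aux_def numeral_eq_Suc One_nat_def sum.atLeast_Suc_lessThan_Suc_shift lessThan_atLeast0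
      by simp
  qed
  have sum_numeral: "(\<Sum>i<numeral k. f i) = (\<Sum>i<pred_numeral k. f i) + f (pred_numeral k)"
    for k and f :: "nat \<Rightarrow> nat"
    by (simp add: numeral_eq_Suc)
  have [simp]: "upper213 (Suc 0) = 1" "upper213_aux 0 = 1" "upper213_aux (Suc 0) = 1"
    by (simp_all add: upper213_Suc upper213_aux_def)
  have [simp]: "upper213 (Suc (Suc 0)) = 2" "upper213 2 = 2"
    using upper213_Suc[of 1] by (simp_all add: numeral_2_eq_2)
  have [simp]: "upper213_aux (Suc (Suc 0)) = 3" "upper213_aux 2 = 3"
    using rec(2)[of "num.Bit0 num.One"] by (simp_all add: numeral_2_eq_2[symmetric])
  have [simp]: "upper213 3 = 6" by (subst rec(1)) (simp add: sum_numeral)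
  have [simp]: "upper213_aux 3 = 9" by (subst rec(2)) (simp add: sum_numeral)
  have [simp]: "upper213 4 = 20" by (subst rec(1)) (simp add: sum_numeral)
  have [simp]: "upper213_aux 4 = 30" by (subst rec(2)) (simp add: sum_numeral)
  have [simp]: "upper213 5 = 71" by (subst rec(1)) (simp add: sum_numeral)
  have [simp]: "upper213_aux 5 = 107" by (subst rec(2)) (simp add: sum_numeral)
  show [simp]: "upper213 6 = 264" by (subst rec(1)) (simp add: sum_numeral)
  have [simp]: "upper213_aux 6 = 399" by (subst rec(2)) (simp add: sum_numeral)
  show [simp]: "upper213 7 = 1015" by (subst rec(1)) (simp add: sum_numeral)
  have [simp]: "upper213_aux 7 = 1537" by (subst rec(2)) (simp add: sum_numeral)
  show [simp]: "upper213 8 = 4002" by (subst rec(1)) (simp add: sum_numeral)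
  have [simp]: "upper213_aux 8 = 6069" by (subst rec(2)) (simp add: sum_numeral)
  show [simp]: "upper213 9 = 16094" by (subst rec(1)) (simp add: sum_numeral)
  have [simp]: "upper213_aux 9 = 24434" by (subst rec(2)) (simp add: sum_numeral)
  show [simp]: "upper213 10 = 65758" by (subst rec(1)) (simp add: sum_numeral)
  have [simp]: "upper213_aux 10 = 99924" by (subst rec(2)) (simp add: sum_numeral)
  show [simp]: "upper213 11 = 272208" by (subst rec(1)) (simp add: sum_numeral)
  have [simp]: "upper213_aux 11 = 413943" by (subst rec(2)) (simp add: sum_numeral)
  show [simp]: "upper213 12 = 1139182" by (subst rec(1)) (simp add: sum_numeral)
  have [simp]: "upper213_aux 12 = 1733394" by (subst rec(2)) (simp add: sum_numeral)
  show [simp]: "upper213 13 = 4811807" by (subst rec(1)) (simp add: sum_numeral)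
  have [simp]: "upper213_aux 13 = 7325471" by (subst rec(2)) (simp add: sum_numeral)
  show [simp]: "upper213 14 = 20487096" by (subst rec(1)) (simp add: sum_numeral)
  have [simp]: "upper213_aux 14 = 31203159" by (subst rec(2)) (simp add: sum_numeral)
  show [simp]: "upper213 15 = 87832558" by (subst rec(1)) (simp add: sum_numeral)
  have [simp]: "upper213_aux 15 = 133825441" by (subst rec(2)) (simp add: sum_numeral)
  show [simp]: "upper213 16 = 378846620" by (subst rec(1)) (simp add: sum_numeral)
  have [simp]: "upper213_aux 16 = 577418430" by (subst rec(2)) (simp add: sum_numeral)
  show [simp]: "upper213 17 = 1642851797" by (subst rec(1)) (simp add: sum_numeral)
  have [simp]: "upper213_aux 17 = 2504681465" by (subst rec(2)) (simp add: sum_numeral)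
  show [simp]: "upper213 18 = 7158220968" by (subst rec(1)) (simp add: sum_numeral)
  have [simp]: "upper213_aux 18 = 10916208453" by (subst rec(2)) (simp add: sum_numeral)
  show [simp]: "upper213 19 = 31323340342" by (subst rec(1)) (simp add: sum_numeral)
  have [simp]: "upper213_aux 19 = 47778816718" by (subst rec(2)) (simp add: sum_numeral)
  show [simp]: "upper213 20 = 137595355130" by (subst rec(1)) (simp add: sum_numeral)
  have [simp]: "upper213_aux 20 = 209923718880" by (subst rec(2)) (simp add: sum_numeral)
  show [simp]: "upper213 21 = 606533278416" by (subst rec(1)) (simp add: sum_numeral)
  have [simp]: "upper213_aux 21 = 925537620996" by (subst rec(2)) (simp add: sum_numeral)
  show [simp]: "upper213 22 = 2682157911032" by (subst rec(1)) (simp add: sum_numeral)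
  have [simp]: "upper213_aux 22 = 4093530000888" by (subst rec(2)) (simp add: sum_numeral)
  show [simp]: "upper213 23 = 11895267124841" by (subst rec(1)) (simp add: sum_numeral)
qed

text \<open>24 is the first index at which the bounds in \<open>lower123_values\<close> exceed
  \<open>3/2 * 5 ^ n\<close>. Three base cases are needed because \<open>lower123_ge\<close> reaches
  back three steps.\<close>

lemma lower123_ge_power: "3 * 5 ^ (24 + n) \<le> 2 * lower123 (24 + n)"
proof (induction n rule: less_induct)
  case (less n)
  consider "n = 0" | "n = 1" | "n = 2" | k where "n = k + 3"
    by (metis One_nat_def add.commute add_2_eq_Suc numeral_3_eq_3 add_Suc not0_implies_Suc plus_1_eq_Suc numeral_2_eq_2)
  then show ?case
  proof cases
    case 4
    define m where "m = 24 + k"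
    have IH: "3 * 5 ^ m \<le> 2 * lower123 m" "15 * 5 ^ m \<le> 2 * lower123 (m + 1)" "75 * 5 ^ m \<le> 2 * lower123 (m + 2)"
      using less.IH[of k] less.IH[of "k + 1"] less.IH[of "k + 2"] 4
      by (simp_all add: m_def add.assoc power_add)
    \<comment> \<open>Crude coefficients suffice: twice the right-hand side of
      \<open>lower123_ge\<close> is then at least
      \<open>(2 * 75 + 20 * 15 + 100 * 3) * 5 ^ m = 750 * 5 ^ m\<close>, twice the required
      \<open>375 * 5 ^ m\<close>.\<close>
    have m: "m + 1 \<ge> 20" "(m + 2) * (m + 1) div 2 \<ge> 100"
    proof -
      show "m + 1 \<ge> 20" by (simp add: m_def)
      then have "21 * 20 \<le> (m + 2) * (m + 1)" by (intro mult_le_mono) auto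
      then show "(m + 2) * (m + 1) div 2 \<ge> 100" by linarith
    qed
    have "20 * lower123 (m + 1) \<le> (m + 1) * lower123 (m + 1)"
      "100 * lower123 m \<le> ((m + 2) * (m + 1) div 2) * lower123 m"
      using m by (intro mult_le_mono; simp)+
    moreover have "3 * 5 ^ (m + 3) = 375 * (5 :: nat) ^ m" by (simp add: power_add)
    ultimately have "3 * 5 ^ (m + 3) \<le> 2 * lower123 (m + 3)"
      using IH lower123_ge[of m] by linarith
    then show ?thesis by (simp add: m_def 4 add.assoc)
  qed (use lower123_values(22,23,24) in simp_all)
qed

lemma upper213_less_lower123:
  assumes "n > 5"
  shows "upper213 n < lower123 n"
proof (cases "n \<ge> 24")
  case True
  \<comment> \<open>Both bounds meet at \<open>3 * 5 ^ n\<close> and are weak; parity makes the one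
    for \<open>upper213\<close> strict.\<close>
  have "odd (3 * 5 ^ n :: nat)" by simp
  then have "2 * upper213 n \<noteq> 3 * 5 ^ n" by (metis dvd_triv_left)
  then show ?thesis
    using upper213_le[of n] lower123_ge_power[of "n - 24"] True by simp
next
  case False
  then have "n \<in> {6..<24}" using assms by simp
  then have "n \<in> set [6..<24]" by (simp only: set_upt)
  then consider "n = 6" | "n = 7" | "n = 8" | "n = 9" | "n = 10" | "n = 11" | "n = 12" | "n = 13" | "n = 14" | "n = 15" | "n = 16" | "n = 17" | "n = 18" | "n = 19" | "n = 20" | "n = 21" | "n = 22" | "n = 23"
    by (auto simp: upt_rec_numeral)
  then show ?thesis
    by cases (use lower123_values upper213_values in simp_all)
qed

lemma adjacent_separated_123_132:
  assumes "n > 5"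
  shows "card (Av n [1,3,2] Adjacent Separated) < card (Av n [1,2,3] Adjacent Separated)"
  unfolding card_Av_123_adj_sep card_Av_132_adj_sep
  using upper213_less_lower123[OF assms] sep_adj213_le_upper213[of "{1..n}"] lower123_le_sep_adj123[of "{1..n}"]
  by simp

section \<open>Fully separated patterns\<close>

text \<open>Here \<open>tl\<close> skips the letter right after \<open>x\<close>; in
  \<open>avoids_sep_sep\<close> a further \<open>tl\<close> skips the letter right after
  \<open>a\<close>.\<close>

fun avoids_sep_pair :: "(nat \<Rightarrow> nat \<Rightarrow> nat \<Rightarrow> bool) \<Rightarrow> nat \<Rightarrow> nat list \<Rightarrow> bool" where
  "avoids_sep_pair R a [] \<longleftrightarrow> True"
| "avoids_sep_pair R a (x # ys) \<longleftrightarrow> (\<forall>y\<in>set (tl ys). \<not> R a x y) \<and> avoids_sep_pair R a ys"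

fun avoids_sep_sep :: "(nat \<Rightarrow> nat \<Rightarrow> nat \<Rightarrow> bool) \<Rightarrow> nat list \<Rightarrow> bool" where
  "avoids_sep_sep R [] \<longleftrightarrow> True"
| "avoids_sep_sep R (a # xs) \<longleftrightarrow> avoids_sep_pair R a (tl xs) \<and> avoids_sep_sep R xs"

lemma ball_set_tl: "(\<forall>y\<in>set (tl ys). P y) \<longleftrightarrow> (\<forall>k. 1 \<le> k \<longrightarrow> k < length ys \<longrightarrow> P (ys ! k))"
proof (cases ys)
  case (Cons z zs)
  show ?thesis
    unfolding Cons by (subst all_nat_split) (auto simp: all_set_conv_all_nth)
qed simp

lemma avoids_sep_pair_iff_nth:
  "avoids_sep_pair R a xs \<longleftrightarrow> (\<forall>j k. j + 2 \<le> k \<longrightarrow> k < length xs \<longrightarrow> \<not> R a (xs ! j) (xs ! k))"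
proof (induction R a xs rule: avoids_sep_pair.induct)
  case (2 R a x ys)
  have "(\<forall>k. 0 + 2 \<le> k \<longrightarrow> k < length (x # ys) \<longrightarrow> \<not> R a ((x # ys) ! 0) ((x # ys) ! k)) \<longleftrightarrow>
      (\<forall>y\<in>set (tl ys). \<not> R a x y)"
    unfolding ball_set_tl by (subst all_nat_split) auto
  moreover have "(\<forall>k. Suc j + 2 \<le> k \<longrightarrow> k < length (x # ys) \<longrightarrow> \<not> R a ((x # ys) ! Suc j) ((x # ys) ! k)) \<longleftrightarrow>
      (\<forall>k. j + 2 \<le> k \<longrightarrow> k < length ys \<longrightarrow> \<not> R a (ys ! j) (ys ! k))" for j
    by (subst all_nat_split) auto
  ultimately show ?case
    using 2 by (subst all_nat_split) simp
qed simp

lemma avoids_sep_sep_iff_nth: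
  "avoids_sep_sep R xs \<longleftrightarrow>
    (\<forall>i j k. i + 2 \<le> j \<longrightarrow> j + 2 \<le> k \<longrightarrow> k < length xs \<longrightarrow> \<not> R (xs ! i) (xs ! j) (xs ! k))"
proof (induction R xs rule: avoids_sep_sep.induct)
  case (2 R a xs)
  have "(\<forall>j k. 0 + 2 \<le> j \<longrightarrow> j + 2 \<le> k \<longrightarrow> k < length (a # xs) \<longrightarrow> \<not> R ((a # xs) ! 0) ((a # xs) ! j) ((a # xs) ! k))
      \<longleftrightarrow> avoids_sep_pair R a (tl xs)"
  proof (cases xs)
    case (Cons z zs)
    have shift: "(\<forall>j. P j) \<longleftrightarrow> P 0 \<and> P (Suc 0) \<and> (\<forall>j. P (Suc (Suc j)))" for P :: "nat \<Rightarrow> bool"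
      by (metis not0_implies_Suc)
    show ?thesis
      unfolding avoids_sep_pair_iff_nth Cons
      by (subst (1) shift, subst (3) shift) auto
  qed simp
  moreover have "(\<forall>j k. Suc i + 2 \<le> j \<longrightarrow> j + 2 \<le> k \<longrightarrow> k < length (a # xs) \<longrightarrow> \<not> R ((a # xs) ! Suc i) ((a # xs) ! j) ((a # xs) ! k))
      \<longleftrightarrow> (\<forall>j k. i + 2 \<le> j \<longrightarrow> j + 2 \<le> k \<longrightarrow> k < length xs \<longrightarrow> \<not> R (xs ! i) (xs ! j) (xs ! k))" for i
    by (subst (1) all_nat_split, subst (2) all_nat_split) auto
  ultimately show ?case
    using 2 by (subst all_nat_split) simp
qed simp

text \<open>Reading a permutation from left to right, \<open>m\<close> is the minimum of the letters up to two places
  before the current one, \<open>l\<close> is the letter just before it, and \<open>ys\<close> is what remains.\<close>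

fun scan :: "(nat \<Rightarrow> nat \<Rightarrow> nat \<Rightarrow> bool) \<Rightarrow> nat \<Rightarrow> nat \<Rightarrow> nat list \<Rightarrow> bool" where
  "scan R m l [] \<longleftrightarrow> True"
| "scan R m l (x # ys) \<longleftrightarrow> (\<forall>y\<in>set (tl ys). \<not> R m x y) \<and> scan R (min m l) x ys"

text \<open>Both patterns begin with their smallest letter, so of two candidates for it the smaller
  one completes every occurrence the other does. A running minimum is therefore memory
  enough.\<close>

lemma scan_iff_avoids:
  assumes "R \<in> {rel123, rel132}"
  shows "scan R m l xs \<longleftrightarrow> avoids_sep_pair R m xs \<and> avoids_sep_pair R l (tl xs) \<and> avoids_sep_sep R xs"
proof -
  have "R (min m l) x y \<longleftrightarrow> R m x y \<or> R l x y" for m l x y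
    using assms by (auto simp: rel_defs min_def)
  then have min: "avoids_sep_pair R (min m l) xs \<longleftrightarrow> avoids_sep_pair R m xs \<and> avoids_sep_pair R l xs" for m l xs
    by (induction xs) auto
  show ?thesis
    by (induction xs arbitrary: m l) (auto simp: min)
qed

text \<open>A sentinel \<open>t\<close> above all letters can never be the smallest letter of an
  occurrence.\<close>

lemma scan_initial:
  assumes R: "R \<in> {rel123, rel132}" and "\<forall>x\<in>set xs. x < t"
  shows "scan R t t xs \<longleftrightarrow> avoids_sep_sep R xs"
proof -
  have "avoids_sep_pair R t ys" if "set ys \<subseteq> set xs" for ys
    using that
  proof (induction ys)
    case (Cons y ys)
    then have "\<forall>z\<in>set (y # ys). z < t" using assms by auto
    then have "\<forall>z\<in>set (tl ys). \<not> R t y z" using R by (cases ys) (auto simp: rel_defs)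
    then show ?case using Cons by simp
  qed simp
  then show ?thesis
    by (simp add: scan_iff_avoids[OF R] list.set_sel(2) subsetI) (metis list.set_sel(2) subsetI tl_Nil)
qed

lemma num_arr_first_letter:
  assumes U: "finite U" "U \<noteq> {}"
  shows "num_arr P U = (\<Sum>x\<in>U. num_arr (\<lambda>ys. P (x # ys)) (U - {x}))"
proof -
  let ?X = "\<lambda>x. arrangements (\<lambda>ys. P (x # ys)) (U - {x})"
  have "arrangements P U = (\<Union>x\<in>U. (#) x ` ?X x)"
  proof (intro equalityI subsetI)
    fix p assume p: "p \<in> arrangements P U"
    with U obtain x ys where s: "p = x # ys" by (cases p) (auto simp: in_arrangements)
    with p have "x \<in> U" "ys \<in> ?X x" by (auto simp: in_arrangements)
    then show "p \<in> (\<Union>x\<in>U. (#) x ` ?X x)" using s by blast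
  next
    fix p assume "p \<in> (\<Union>x\<in>U. (#) x ` ?X x)"
    then obtain x ys where "p = x # ys" "x \<in> U" "ys \<in> ?X x" by blast
    then show "p \<in> arrangements P U" by (simp add: in_arrangements insert_absorb)
  qed
  moreover have "card (\<Union>x\<in>U. (#) x ` ?X x) = (\<Sum>x\<in>U. card ((#) x ` ?X x))"
    using U by (intro card_UN_disjoint) auto
  ultimately show ?thesis
    unfolding num_arr_def by (simp add: card_image)
qed

text \<open>Letters satisfying \<open>P\<close> are barred from every place but the first, so at
  most one may remain, and that one has to come next.\<close>

lemma num_arr_tl_restricted:
  assumes U: "finite U"
  shows "{y\<in>U. P y} = {} \<Longrightarrow> num_arr (\<lambda>ys. (\<forall>y\<in>set (tl ys). \<not> P y) \<and> Q ys) U = num_arr Q U"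
    and "{y\<in>U. P y} = {z} \<Longrightarrow>
      num_arr (\<lambda>ys. (\<forall>y\<in>set (tl ys). \<not> P y) \<and> Q ys) U = num_arr (\<lambda>zs. Q (z # zs)) (U - {z})"
    and "card {y\<in>U. P y} \<ge> 2 \<Longrightarrow> num_arr (\<lambda>ys. (\<forall>y\<in>set (tl ys). \<not> P y) \<and> Q ys) U = 0"
proof -
  let ?T = "\<lambda>ys. (\<forall>y\<in>set (tl ys). \<not> P y) \<and> Q ys"
  show "num_arr ?T U = num_arr Q U" if "{y\<in>U. P y} = {}"
  proof -
    have "\<not> P y" if "y \<in> set (tl ys)" "set ys = U" for y ys
      using that \<open>{y\<in>U. P y} = {}\<close> by (cases ys) auto
    then have "arrangements ?T U = arrangements Q U" by (auto simp: in_arrangements)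
    then show ?thesis by (simp add: num_arr_def)
  qed
  show "num_arr ?T U = num_arr (\<lambda>zs. Q (z # zs)) (U - {z})" if z: "{y\<in>U. P y} = {z}"
  proof -
    have zU: "z \<in> U" "P z" using z by auto
    have other: "\<not> P y" if "y \<in> U" "y \<noteq> z" for y using that z by blast
    have "arrangements ?T U = (#) z ` arrangements (\<lambda>zs. Q (z # zs)) (U - {z})"
    proof (intro equalityI subsetI)
      fix p assume p: "p \<in> arrangements ?T U"
      then have "z \<in> set p" using zU by (simp add: in_arrangements)
      moreover have "z \<notin> set (tl p)" using p zU by (auto simp: in_arrangements)
      ultimately obtain zs where "p = z # zs" by (cases p) auto
      then show "p \<in> (#) z ` arrangements (\<lambda>zs. Q (z # zs)) (U - {z})"
        using p by (auto simp: in_arrangements)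
    next
      fix p assume "p \<in> (#) z ` arrangements (\<lambda>zs. Q (z # zs)) (U - {z})"
      then obtain zs where p: "p = z # zs" "set zs = U - {z}" "distinct zs" "Q (z # zs)"
        by (auto simp: in_arrangements)
      then show "p \<in> arrangements ?T U"
        using other zU(1) by (simp add: in_arrangements insert_absorb)
    qed
    then show ?thesis by (simp add: num_arr_def card_image)
  qed
  show "num_arr ?T U = 0" if two: "card {y\<in>U. P y} \<ge> 2"
  proof -
    have "arrangements ?T U = {}"
    proof (rule ccontr)
      assume "arrangements ?T U \<noteq> {}"
      then obtain p where "p \<in> arrangements ?T U" by blast
      then have p: "set p = U" "\<forall>y\<in>set (tl p). \<not> P y" by (simp_all add: in_arrangements)
      then have "{y\<in>U. P y} \<subseteq> {hd p}" by (cases p) auto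
      then have "card {y\<in>U. P y} \<le> 1" using card_mono[of "{hd p}" "{y\<in>U. P y}"] by simp
      then show False using two by simp
    qed
    then show ?thesis by (simp add: num_arr_def)
  qed
qed

text \<open>The number of completions of a state with \<open>a\<close> remaining letters below both \<open>m\<close> and \<open>l\<close>,
  \<open>b\<close> strictly between \<open>l\<close> and \<open>m\<close>, and \<open>v\<close> above \<open>m\<close>. Only a letter above \<open>m\<close> is
  constrained: it has to be the largest remaining letter (for 123) or the smallest one above \<open>m\<close>
  (for 132), or else the second one in that order, in which case the first one must follow at once.\<close>

function completions123 :: "nat \<Rightarrow> nat \<Rightarrow> nat \<Rightarrow> nat" where
  "completions123 a b v =
    (if a + b + v = 0 then 1
     else (\<Sum>k<a. completions123 (a - 1 - k) k (b + v)) +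
       (if b = 0 then 0 else b * completions123 a 0 (b + v - 1)) +
       (if v = 0 then 0 else completions123 a 0 (b + v - 1)) +
       (if v < 2 then 0 else completions123 a 0 (b + v - 2)))"
  by pat_completeness auto
termination by (relation "measure (\<lambda>(a, b, v). a + b + v)") auto

text \<open>In the last summand, once the smallest letter \<open>z\<close> above \<open>m\<close>
  has been placed, exactly the \<open>b\<close> letters between \<open>l\<close> and
  \<open>m\<close> are barred from all but the next place. With \<open>b = 0\<close> nothing is
  barred, with \<open>b = 1\<close> that letter must follow and is used up, and
  \<open>b \<ge> 2\<close> is impossible; hence \<open>v - 2\<close> in both possible cases.\<close>

function completions132 :: "nat \<Rightarrow> nat \<Rightarrow> nat \<Rightarrow> nat" where
  "completions132 a b v =
    (if a + b + v = 0 then 1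
     else (\<Sum>k<a. completions132 (a - 1 - k) k (b + v)) +
       (if b = 0 then 0 else b * completions132 a 0 (b + v - 1)) +
       (if v = 0 then 0 else completions132 a 0 (b + v - 1)) +
       (if v < 2 \<or> b \<ge> 2 then 0 else completions132 a 0 (v - 2)))"
  by pat_completeness auto
termination by (relation "measure (\<lambda>(a, b, v). a + b + v)") auto

declare completions123.simps [simp del] completions132.simps [simp del]

section \<open>Comparison of the two completion counts\<close>

lemma completions123_step: "completions123 a 0 v \<le> completions123 a 0 (Suc v)"
  by (subst (2) completions123.simps) simp

lemma completions123_pos: "0 < completions123 a 0 v"
proof (induction v)
  case 0
  show ?case
  proof (induction a)
    case 0
    show ?case by (simp add: completions123.simps)
  next
    case (Suc a)
    have "completions123 a 0 0 \<le> (\<Sum>k<Suc a. completions123 (Suc a - 1 - k) k 0)"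
      using member_le_sum[of 0 "{..<Suc a}" "\<lambda>k. completions123 (Suc a - 1 - k) k 0"] by simp
    also have "\<dots> = completions123 (Suc a) 0 0"
      by (subst (2) completions123.simps) simp
    finally show ?case using Suc by linarith
  qed
next
  case (Suc v)
  then show ?case using completions123_step[of a v] by linarith
qed

text \<open>Only the last summands differ. For \<open>b < 2\<close>, \<open>v - 2\<close> equals
  \<open>b + v - 2\<close> or is one less, and \<open>completions123_step\<close> bridges the
  gap.\<close>

lemma completions132_le_completions123: "completions132 a b v \<le> completions123 a b v"
proof (induction "a + b + v" arbitrary: a b v rule: less_induct)
  case less
  show ?case
  proof (cases "a + b + v = 0")
    case False
    have 1: "(\<Sum>k<a. completions132 (a - 1 - k) k (b + v)) \<le> (\<Sum>k<a. completions123 (a - 1 - k) k (b + v))"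
      by (intro sum_mono less) auto
    have 2: "completions132 a 0 (b + v - 1) \<le> completions123 a 0 (b + v - 1)" if "b + v \<noteq> 0"
      using that by (intro less) auto
    have 3: "completions132 a 0 (v - 2) \<le> completions123 a 0 (b + v - 2)" if "v \<ge> 2" "b < 2"
    proof -
      have "completions132 a 0 (v - 2) \<le> completions123 a 0 (v - 2)"
        using that by (intro less) auto
      also have "\<dots> \<le> completions123 a 0 (b + v - 2)"
      proof -
        have "b + v - 2 = v - 2 \<or> b + v - 2 = Suc (v - 2)" using that by linarith
        then show ?thesis using completions123_step[of a "v - 2"] by auto
      qed
      finally show ?thesis .
    qed
    show ?thesis
      unfolding completions132.simps[of a b v] completions123.simps[of a b v] if_not_P[OF False]
      by (intro add_mono) (use 1 2 3 in auto)
  qed (simp add: completions132.simps completions123.simps)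
qed

text \<open>Carries a strict inequality from a successor state back to a state with
  \<open>v = 0\<close>, where the summands for letters above \<open>m\<close> vanish on both
  sides.\<close>

lemma completions132_less_step:
  assumes "k < a" "completions132 (a - 1 - k) k (b + v) < completions123 (a - 1 - k) k (b + v)" "v = 0"
  shows "completions132 a b v < completions123 a b v"
proof -
  have "(\<Sum>k<a. completions132 (a - 1 - k) k (b + v)) < (\<Sum>k<a. completions123 (a - 1 - k) k (b + v))"
    using assms completions132_le_completions123 by (intro sum_strict_mono_ex1) auto
  moreover have "a + b + v \<noteq> 0" using assms by simp
  ultimately show ?thesis
    unfolding completions132.simps[of a b v] completions123.simps[of a b v] if_not_P[OF \<open>a + b + v \<noteq> 0\<close>]
    by (intro add_less_le_mono add_mono) (use completions132_le_completions123 assms in auto)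
qed

text \<open>Choosing \<open>k = 2\<close> twice leads from \<open>(n, 0, 0)\<close> through
  \<open>(n - 3, 2, 0)\<close> to \<open>(n - 6, 2, 2)\<close>. There \<open>b = 2\<close> kills the
  last summand for 132, while for 123 it is the positive number
  \<open>completions123 (n - 6) 0 2\<close>.\<close>

lemma completions132_less_completions123:
  assumes "n \<ge> 6"
  shows "completions132 n 0 0 < completions123 n 0 0"
proof -
  have "completions132 (n - 6) 2 2 < completions123 (n - 6) 2 2"
  proof -
    have "(\<Sum>k<n - 6. completions132 (n - 6 - 1 - k) k 4) \<le> (\<Sum>k<n - 6. completions123 (n - 6 - 1 - k) k 4)"
      by (intro sum_mono completions132_le_completions123)
    then show ?thesis
      using completions132_le_completions123[of "n - 6" 0 3] completions123_pos[of "n - 6" 2]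
      unfolding completions132.simps[of _ 2 2] completions123.simps[of _ 2 2] by simp
  qed
  moreover have "n - 3 - 1 - 2 = n - 6" by simp
  ultimately have "completions132 (n - 3) 2 0 < completions123 (n - 3) 2 0"
    using assms by - (rule completions132_less_step[of 2], simp_all)
  moreover have "n - 1 - 2 = n - 3" by simp
  ultimately show ?thesis
    using assms by - (rule completions132_less_step[of 2], simp_all)
qed

text \<open>The part of the recurrence common to both patterns, with the induction hypothesis as a
  premise on an abstract \<open>C\<close>. A next letter from \<open>A\<close> or \<open>B\<close>
  lies below \<open>m\<close> and so is unconstrained. If it comes from \<open>A\<close>, the
  \<open>k\<close> letters of \<open>A\<close> above it become the middle range, and
  \<open>B\<close> and \<open>W\<close> lie above the new minimum. Any other next letter leaves
  \<open>A\<close> intact and the middle range empty.\<close>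

lemma num_arr_scan:
  fixes m l :: nat and U :: "nat set"
  assumes R: "R \<in> {rel123, rel132}"
    and U: "finite U" "U \<noteq> {}" "m \<notin> U" "l \<notin> U"
    and IH: "\<And>U' m l. \<lbrakk>U' \<subset> U; m \<notin> U'; l \<notin> U'\<rbrakk> \<Longrightarrow>
      num_arr (scan R m l) U' = C (card {u\<in>U'. u < m \<and> u < l}) (card {u\<in>U'. l < u \<and> u < m}) (card {u\<in>U'. m < u})"
  defines "A \<equiv> {u\<in>U. u < m \<and> u < l}" and "B \<equiv> {u\<in>U. l < u \<and> u < m}" and "W \<equiv> {u\<in>U. m < u}"
  shows num_arr_scan_above: "\<And>x U'. \<lbrakk>x \<in> U; min m l < x; U' \<subseteq> U - {x}; A \<subseteq> U'\<rbrakk> \<Longrightarrow>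
      num_arr (scan R (min m l) x) U' = C (card A) 0 (card U' - card A)"
    and card_scan_state: "card U = card A + card B + card W"
    and num_arr_scan_first: "num_arr (scan R m l) U =
      (\<Sum>k<card A. C (card A - 1 - k) k (card B + card W)) +
      card B * C (card A) 0 (card B + card W - 1) +
      (\<Sum>x\<in>W. num_arr (\<lambda>ys. (\<forall>y\<in>set (tl ys). \<not> R m x y) \<and> scan R (min m l) x ys) (U - {x}))"
proof -
  let ?m = "min m l"
  have fin: "finite A" "finite B" "finite W" using U by (auto simp: A_def B_def W_def)
  have disj: "A \<inter> (B \<union> W) = {}" "B \<inter> W = {}" by (auto simp: A_def B_def W_def)
  have UABW: "U = A \<union> (B \<union> W)"
  proof (intro equalityI subsetI)
    fix u assume u: "u \<in> U"
    then have "u \<noteq> m" "u \<noteq> l" using U by auto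
    then show "u \<in> A \<union> (B \<union> W)" using u unfolding A_def B_def W_def by simp linarith
  qed (auto simp: A_def B_def W_def)
  have cBW: "card (B \<union> W) = card B + card W"
    using fin disj by (intro card_Un_disjoint)
  show cU: "card U = card A + card B + card W"
    using card_Un_disjoint[OF fin(1) _ disj(1)] fin cBW by (simp add: UABW[symmetric])
  show above: "num_arr (scan R ?m x) U' = C (card A) 0 (card U' - card A)"
    if x: "x \<in> U" "?m < x" and U': "U' \<subseteq> U - {x}" "A \<subseteq> U'" for x U'
  proof -
    have 1: "{u\<in>U'. u < ?m \<and> u < x} = A" using x U' by (auto simp: A_def)
    have 2: "{u\<in>U'. x < u \<and> u < ?m} = {}" using x by auto
    have 3: "{u\<in>U'. ?m < u} = U' - A"
    proof (intro equalityI subsetI)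
      fix u assume "u \<in> U' - A"
      then have "u \<in> U'" "u \<in> B \<union> W" using U' UABW by auto
      then show "u \<in> {u\<in>U'. ?m < u}" by (auto simp: B_def W_def)
    qed (auto simp: A_def)
    have "U' \<subset> U" "?m \<notin> U'" "x \<notin> U'" using U' x(1) U by (auto simp: min_def)
    then have "num_arr (scan R ?m x) U' = C (card A) 0 (card (U' - A))"
      using IH[of U' ?m x] unfolding 1 2 3 by simp
    then show ?thesis using fin U' by (simp add: card_Diff_subset)
  qed
  have low: "num_arr (scan R ?m x) (U - {x}) =
      C (card A - 1 - card {z\<in>A. x < z}) (card {z\<in>A. x < z}) (card B + card W)" if x: "x \<in> A" for x
  proof -
    have 1: "{u\<in>U - {x}. u < ?m \<and> u < x} = {z\<in>A. z < x}" using x by (auto simp: A_def)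
    have 2: "{u\<in>U - {x}. x < u \<and> u < ?m} = {z\<in>A. x < z}" by (auto simp: A_def)
    have 3: "{u\<in>U - {x}. ?m < u} = B \<union> W"
    proof (intro equalityI subsetI)
      fix u assume "u \<in> {u\<in>U - {x}. ?m < u}"
      then have "u \<in> U" "u \<notin> A" by (auto simp: A_def)
      then show "u \<in> B \<union> W" using UABW by auto
    next
      fix u assume "u \<in> B \<union> W"
      then show "u \<in> {u\<in>U - {x}. ?m < u}" using disj x by (auto simp: B_def W_def)
    qed
    have "A = {z\<in>A. z < x} \<union> insert x {z\<in>A. x < z}" using x by auto
    moreover have "{z\<in>A. z < x} \<inter> {z\<in>A. x < z} = {}" by auto
    ultimately have "card A = card {z\<in>A. z < x} + Suc (card {z\<in>A. x < z})"
      using fin card_Un_disjoint[of "{z\<in>A. z < x}" "insert x {z\<in>A. x < z}"] by auto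
    then have "card {z\<in>A. z < x} = card A - 1 - card {z\<in>A. x < z}" by simp
    moreover have "U - {x} \<subset> U" "?m \<notin> U - {x}" using x U by (auto simp: A_def min_def)
    ultimately show ?thesis
      using IH[of "U - {x}" ?m x] unfolding 1 2 3 cBW by simp
  qed
  let ?H = "\<lambda>x. num_arr (\<lambda>ys. (\<forall>y\<in>set (tl ys). \<not> R m x y) \<and> scan R ?m x ys) (U - {x})"
  have free: "?H x = num_arr (scan R ?m x) (U - {x})" if "x \<in> A \<union> B" for x
  proof -
    have "\<not> R m x y" for y using that R by (auto simp: A_def B_def rel_defs)
    then show ?thesis by simp
  qed
  have "num_arr (scan R m l) U = (\<Sum>x\<in>U. ?H x)"
    by (subst num_arr_first_letter[OF U(1,2)]) simp
  also have "\<dots> = (\<Sum>x\<in>A. ?H x) + ((\<Sum>x\<in>B. ?H x) + (\<Sum>x\<in>W. ?H x))"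
    unfolding UABW[THEN sum.cong[OF _ refl]] using fin disj
    by (subst sum.union_disjoint; (subst sum.union_disjoint)?) auto
  also have "(\<Sum>x\<in>A. ?H x) = (\<Sum>x\<in>A. C (card A - 1 - card {z\<in>A. x < z}) (card {z\<in>A. x < z}) (card B + card W))"
    using free low by (intro sum.cong) auto
  also have "\<dots> = (\<Sum>k<card A. C (card A - 1 - k) k (card B + card W))"
    by (rule sum_card_greater[OF fin(1)])
  also have "(\<Sum>x\<in>B. ?H x) = (\<Sum>x\<in>B. C (card A) 0 (card B + card W - 1))"
  proof (rule sum.cong)
    fix x assume x: "x \<in> B"
    then have "x \<in> U" "?m < x" "A \<subseteq> U - {x}" by (auto simp: A_def B_def)
    then have "num_arr (scan R ?m x) (U - {x}) = C (card A) 0 (card (U - {x}) - card A)"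
      by (intro above) auto
    moreover have "card (U - {x}) - card A = card B + card W - 1"
      using cU \<open>x \<in> U\<close> U(1) by simp
    ultimately show "?H x = C (card A) 0 (card B + card W - 1)"
      using free[of x] x by simp
  qed simp
  finally show "num_arr (scan R m l) U =
      (\<Sum>k<card A. C (card A - 1 - k) k (card B + card W)) +
      card B * C (card A) 0 (card B + card W - 1) + (\<Sum>x\<in>W. ?H x)"
    by simp
qed

lemma sum_first_two:
  fixes g :: "nat \<Rightarrow> nat"
  assumes "\<And>j. j \<ge> 2 \<Longrightarrow> g j = 0"
  shows "(\<Sum>j<v. g j) = (if v = 0 then 0 else g 0) + (if v < 2 then 0 else g 1)"
proof -
  consider "v = 0" | "v = 1" | w where "v = Suc (Suc w)"
    by (metis One_nat_def not0_implies_Suc)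
  then show ?thesis
    using assms by cases (simp_all add: sum.lessThan_Suc_shift del: sum.lessThan_Suc)
qed

lemma num_arr_scan123:
  "\<lbrakk>finite U; m \<notin> U; l \<notin> U\<rbrakk> \<Longrightarrow> num_arr (scan rel123 m l) U =
    completions123 (card {u\<in>U. u < m \<and> u < l}) (card {u\<in>U. l < u \<and> u < m}) (card {u\<in>U. m < u})"
proof (induction "card U" arbitrary: U m l rule: less_induct)
  case less
  show ?case
  proof (cases "U = {}")
    case True
    then show ?thesis by (simp add: num_arr_empty completions123.simps)
  next
    case False
    define A where "A = {u\<in>U. u < m \<and> u < l}"
    define B where "B = {u\<in>U. l < u \<and> u < m}"
    define W where "W = {u\<in>U. m < u}"
    let ?m = "min m l"
    have IH: "num_arr (scan rel123 m l) U' =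
      completions123 (card {u\<in>U'. u < m \<and> u < l}) (card {u\<in>U'. l < u \<and> u < m}) (card {u\<in>U'. m < u})"
      if "U' \<subset> U" "m \<notin> U'" "l \<notin> U'" for U' m l
      using that less by (meson finite_subset psubset_card_mono psubset_imp_subset)
    note scan = num_arr_scan[of rel123 U m l completions123, OF _ less.prems(1) False less.prems(2,3) IH, folded A_def B_def W_def, simplified]
    let ?g = "\<lambda>j :: nat. if j = 0 then completions123 (card A) 0 (card B + card W - 1)
      else if j = 1 then completions123 (card A) 0 (card B + card W - 2) else 0"
    have "num_arr (\<lambda>ys. (\<forall>y\<in>set (tl ys). \<not> rel123 m x y) \<and> scan rel123 ?m x ys) (U - {x}) = ?g (card {z\<in>W. x < z})"
      (is "?N = _") if x: "x \<in> W" for x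
    proof -
      have xU: "x \<in> U" "?m < x" "m < x" "A \<subseteq> U - {x}" using x by (auto simp: A_def W_def)
      have eq: "{y\<in>U - {x}. rel123 m x y} = {z\<in>W. x < z}"
        using xU by (auto simp: W_def rel_defs)
      have fin: "finite (U - {x})" "finite {z\<in>W. x < z}" using less.prems by (auto simp: W_def)
      note restrict = num_arr_tl_restricted[OF fin(1), where P = "rel123 m x" and Q = "scan rel123 ?m x", unfolded eq]
      consider "card {z\<in>W. x < z} = 0" | "card {z\<in>W. x < z} = 1" | "card {z\<in>W. x < z} \<ge> 2" by linarith
      then show ?thesis
      proof cases
        case 1
        then have "{z\<in>W. x < z} = {}" using fin by (simp only: card_0_eq)
        then have "?N = num_arr (scan rel123 ?m x) (U - {x})" by (rule restrict(1))
        also have "\<dots> = completions123 (card A) 0 (card (U - {x}) - card A)"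
          using xU by (intro scan(1)) auto
        finally show ?thesis using 1 scan(2) xU(1) less.prems(1) by simp
      next
        case 2
        then obtain z where z: "{z\<in>W. x < z} = {z}" by (rule card_1_singletonE)
        have zU: "z \<in> U" "m < z" "x < z" "z \<noteq> x" using z by (auto simp: W_def)
        \<comment> \<open>\<open>z\<close> is the largest remaining letter, so placing it bars
          nothing.\<close>
        have none: "{y\<in>U - {x} - {z}. rel123 ?m z y} = {}"
        proof -
          have "y = z" if "y \<in> U" "z < y" for y
          proof -
            have "y \<in> {z\<in>W. x < z}" using that zU by (auto simp: W_def)
            then show ?thesis unfolding z by simp
          qed
          then show ?thesis by (auto simp: rel_defs)
        qed
        have "min ?m x = ?m" using xU by simp
        then have "?N = num_arr (\<lambda>zs. (\<forall>y\<in>set (tl zs). \<not> rel123 ?m z y) \<and> scan rel123 ?m z zs) (U - {x} - {z})"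
          using restrict(2)[OF z] by simp
        also have "\<dots> = num_arr (scan rel123 ?m z) (U - {x} - {z})"
          using fin by (intro num_arr_tl_restricted(1) none) auto
        also have "\<dots> = completions123 (card A) 0 (card (U - {x} - {z}) - card A)"
          using zU xU by (intro scan(1)) (auto simp: A_def)
        also have "card (U - {x} - {z}) - card A = card B + card W - 2"
          using scan(2) xU(1) zU(1,4) less.prems(1) by simp
        finally show ?thesis using 2 by simp
      next
        case 3
        moreover have "?g j = 0" if "2 \<le> j" for j using that by auto
        ultimately show ?thesis using restrict(3)[OF 3] by (simp only:)
      qed
    qed
    then have "(\<Sum>x\<in>W. num_arr (\<lambda>ys. (\<forall>y\<in>set (tl ys). \<not> rel123 m x y) \<and> scan rel123 ?m x ys) (U - {x}))
        = (\<Sum>x\<in>W. ?g (card {z\<in>W. x < z}))"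
      by (rule sum.cong[OF refl])
    also have "\<dots> = (\<Sum>j<card W. ?g j)"
      using less.prems by (intro sum_card_greater) (simp add: W_def)
    also have "\<dots> = (if card W = 0 then 0 else ?g 0) + (if card W < 2 then 0 else ?g 1)"
      by (rule sum_first_two[of ?g]) auto
    finally have W: "(\<Sum>x\<in>W. num_arr (\<lambda>ys. (\<forall>y\<in>set (tl ys). \<not> rel123 m x y) \<and> scan rel123 ?m x ys) (U - {x})) = \<dots>" .
    have "card A + card B + card W \<noteq> 0" using scan(2) False less.prems(1) by (metis card_0_eq)
    then show ?thesis
      unfolding A_def[symmetric] B_def[symmetric] W_def[symmetric]
      by (subst completions123.simps) (use scan(3) W in simp)
  qed
qed

lemma num_arr_scan132:
  "\<lbrakk>finite U; m \<notin> U; l \<notin> U\<rbrakk> \<Longrightarrow> num_arr (scan rel132 m l) U =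
    completions132 (card {u\<in>U. u < m \<and> u < l}) (card {u\<in>U. l < u \<and> u < m}) (card {u\<in>U. m < u})"
proof (induction "card U" arbitrary: U m l rule: less_induct)
  case less
  show ?case
  proof (cases "U = {}")
    case True
    then show ?thesis by (simp add: num_arr_empty completions132.simps)
  next
    case False
    define A where "A = {u\<in>U. u < m \<and> u < l}"
    define B where "B = {u\<in>U. l < u \<and> u < m}"
    define W where "W = {u\<in>U. m < u}"
    let ?m = "min m l"
    have IH: "num_arr (scan rel132 m l) U' =
      completions132 (card {u\<in>U'. u < m \<and> u < l}) (card {u\<in>U'. l < u \<and> u < m}) (card {u\<in>U'. m < u})"
      if "U' \<subset> U" "m \<notin> U'" "l \<notin> U'" for U' m l
      using that less by (meson finite_subset psubset_card_mono psubset_imp_subset)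
    note scan = num_arr_scan[of rel132 U m l completions132, OF _ less.prems(1) False less.prems(2,3) IH, folded A_def B_def W_def, simplified]
    let ?g = "\<lambda>j :: nat. if j = 0 then completions132 (card A) 0 (card B + card W - 1)
      else if j = 1 \<and> card B < 2 then completions132 (card A) 0 (card W - 2) else 0"
    have "num_arr (\<lambda>ys. (\<forall>y\<in>set (tl ys). \<not> rel132 m x y) \<and> scan rel132 ?m x ys) (U - {x}) = ?g (card {z\<in>W. z < x})"
      (is "?N = _") if x: "x \<in> W" for x
    proof -
      have xU: "x \<in> U" "?m < x" "m < x" "A \<subseteq> U - {x}" using x by (auto simp: A_def W_def)
      have eq: "{y\<in>U - {x}. rel132 m x y} = {z\<in>W. z < x}"
        using xU by (auto simp: W_def rel_defs)
      have fin: "finite (U - {x})" "finite {z\<in>W. z < x}" "finite B" using less.prems by (auto simp: W_def B_def)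
      note restrict = num_arr_tl_restricted[OF fin(1), where P = "rel132 m x" and Q = "scan rel132 ?m x", unfolded eq]
      consider "card {z\<in>W. z < x} = 0" | "card {z\<in>W. z < x} = 1" | "card {z\<in>W. z < x} \<ge> 2" by linarith
      then show ?thesis
      proof cases
        case 1
        then have "{z\<in>W. z < x} = {}" using fin by (simp only: card_0_eq)
        then have "?N = num_arr (scan rel132 ?m x) (U - {x})" by (rule restrict(1))
        also have "\<dots> = completions132 (card A) 0 (card (U - {x}) - card A)"
          using xU by (intro scan(1)) auto
        finally show ?thesis using 1 scan(2) xU(1) less.prems(1) by simp
      next
        case 2
        then obtain z where z: "{z\<in>W. z < x} = {z}" by (rule card_1_singletonE)
        have zU: "z \<in> U" "m < z" "z < x" "z \<noteq> x" using z by (auto simp: W_def)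
        \<comment> \<open>\<open>z\<close> is the smallest letter above \<open>m\<close>, so the
          letters between \<open>min m l\<close> and \<open>z\<close> are those of \<open>B\<close>;
          the size of \<open>B\<close> decides how to go on.\<close>
        have between: "{y\<in>U - {x} - {z}. rel132 ?m z y} = B"
        proof (intro equalityI subsetI)
          fix y assume y: "y \<in> {y\<in>U - {x} - {z}. rel132 ?m z y}"
          then have "y \<in> U" "y < z" "?m < y" "y \<noteq> z" by (auto simp: rel_defs)
          then have "y \<notin> {z\<in>W. z < x}" unfolding z by simp
          then have "\<not> m < y" using \<open>y \<in> U\<close> \<open>y < z\<close> zU by (auto simp: W_def)
          moreover have "y \<noteq> m" using \<open>y \<in> U\<close> less.prems by auto
          ultimately show "y \<in> B" using \<open>y \<in> U\<close> \<open>?m < y\<close> by (auto simp: B_def)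
        next
          fix y assume "y \<in> B"
          then show "y \<in> {y\<in>U - {x} - {z}. rel132 ?m z y}"
            using zU xU by (auto simp: B_def rel_defs)
        qed
        have "min ?m x = ?m" using xU by simp
        then have N: "?N = num_arr (\<lambda>zs. (\<forall>y\<in>set (tl zs). \<not> rel132 ?m z y) \<and> scan rel132 ?m z zs) (U - {x} - {z})"
          using restrict(2)[OF z] by simp
        have fin': "finite (U - {x} - {z})" using less.prems by simp
        note restrict' = num_arr_tl_restricted[OF fin', where P = "rel132 ?m z" and Q = "scan rel132 ?m z", unfolded between, folded N]
        consider "card B = 0" | "card B = 1" | "card B \<ge> 2" by linarith
        then show ?thesis
        proof cases
          case 1
          then have "B = {}" using fin by simp
          then have "?N = num_arr (scan rel132 ?m z) (U - {x} - {z})" by (rule restrict'(1))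
          also have "\<dots> = completions132 (card A) 0 (card (U - {x} - {z}) - card A)"
            using zU xU by (intro scan(1)) (auto simp: A_def)
          also have "card (U - {x} - {z}) - card A = card W - 2"
            using scan(2) xU(1) zU(1,4) less.prems(1) 1 by simp
          finally show ?thesis using 1 2 by simp
        next
          case one: 2
          then obtain w where w: "B = {w}" by (rule card_1_singletonE)
          then have "w \<in> B" by simp
          then have wU: "w \<in> U" "?m < w" "w < m" "w \<noteq> x" "w \<noteq> z" using xU zU by (auto simp: B_def)
          \<comment> \<open>\<open>w\<close> was the only letter of \<open>B\<close>, so placing it
            bars nothing further.\<close>
          have none: "{y\<in>U - {x} - {z} - {w}. rel132 ?m w y} = {}"
          proof -
            have "y = w" if "y \<in> U" "?m < y" "y < w" for y
            proof -
              have "y \<in> B" using that wU by (auto simp: B_def)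
              then show ?thesis unfolding w by simp
            qed
            then show ?thesis by (auto simp: rel_defs)
          qed
          have "min ?m z = ?m" using zU by simp
          then have "?N = num_arr (\<lambda>zs. (\<forall>y\<in>set (tl zs). \<not> rel132 ?m w y) \<and> scan rel132 ?m w zs) (U - {x} - {z} - {w})"
            using restrict'(2)[OF w] by simp
          also have "\<dots> = num_arr (scan rel132 ?m w) (U - {x} - {z} - {w})"
            using fin by (intro num_arr_tl_restricted(1) none) auto
          also have "\<dots> = completions132 (card A) 0 (card (U - {x} - {z} - {w}) - card A)"
            using zU xU wU by (intro scan(1)) (auto simp: A_def)
          also have "card (U - {x} - {z} - {w}) - card A = card W - 2"
            using scan(2) xU(1) zU(1,4) wU less.prems(1) one by simp
          finally show ?thesis using one 2 by simp
        next
          case 3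
          then show ?thesis using restrict'(3) 2 by simp
        qed
      next
        case 3
        moreover have "?g j = 0" if "2 \<le> j" for j using that by auto
        ultimately show ?thesis using restrict(3)[OF 3] by (simp only:)
      qed
    qed
    then have "(\<Sum>x\<in>W. num_arr (\<lambda>ys. (\<forall>y\<in>set (tl ys). \<not> rel132 m x y) \<and> scan rel132 ?m x ys) (U - {x}))
        = (\<Sum>x\<in>W. ?g (card {z\<in>W. z < x}))"
      by (rule sum.cong[OF refl])
    also have "\<dots> = (\<Sum>j<card W. ?g j)"
      using less.prems by (intro sum_card_less) (simp add: W_def)
    also have "\<dots> = (if card W = 0 then 0 else ?g 0) + (if card W < 2 then 0 else ?g 1)"
      by (rule sum_first_two[of ?g]) auto
    finally have W: "(\<Sum>x\<in>W. num_arr (\<lambda>ys. (\<forall>y\<in>set (tl ys). \<not> rel132 m x y) \<and> scan rel132 ?m x ys) (U - {x})) = \<dots>" .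
    have "card A + card B + card W \<noteq> 0" using scan(2) False less.prems(1) by (metis card_0_eq)
    then show ?thesis
      unfolding A_def[symmetric] B_def[symmetric] W_def[symmetric]
      by (subst completions132.simps) (use scan(3) W in simp)
  qed
qed

lemma separated_separated_123_132:
  assumes "n \<ge> 6"
  shows "card (Av n [1,3,2] Separated Separated) < card (Av n [1,2,3] Separated Separated)"
proof -
  have Av: "Av n q Separated Separated = arrangements (avoids_sep_sep R) {1..n}"
    if "\<And>a b c. order_isomorphic [a, b, c] q \<longleftrightarrow> R a b c" for R q
    by (rule Av_eq_arrangements) (auto simp: avoids_sep_sep_iff_nth occurrence_def that)
  have scan: "arrangements (avoids_sep_sep R) {1..n} = arrangements (scan R (Suc n) (Suc n)) {1..n}"
    if "R \<in> {rel123, rel132}" for R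
    using scan_initial[OF that, of _ "Suc n"] by (auto simp: in_arrangements)
  \<comment> \<open>With the sentinel \<open>Suc n\<close> as both \<open>m\<close> and
    \<open>l\<close>, all letters lie below both, which is the state
    \<open>(n, 0, 0)\<close>.\<close>
  have "{u\<in>{1..n}. u < Suc n \<and> u < Suc n} = {1..n}" "{u\<in>{1..n}. Suc n < u \<and> u < Suc n} = {}"
    "{u\<in>{1..n}. Suc n < u} = {}"
    by auto
  then have "num_arr (scan rel123 (Suc n) (Suc n)) {1..n} = completions123 n 0 0"
    "num_arr (scan rel132 (Suc n) (Suc n)) {1..n} = completions132 n 0 0"
    using num_arr_scan123[of "{1..n}" "Suc n" "Suc n"] num_arr_scan132[of "{1..n}" "Suc n" "Suc n"]
    by (simp_all only: finite_atLeastAtMost card_atLeastAtMost card.empty atLeastAtMost_iff diff_Suc_1) auto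
  then show ?thesis
    using completions132_less_completions123[OF assms] Av[OF order_isomorphic_123] Av[OF order_isomorphic_132]
      scan[of rel123] scan[of rel132]
    by (simp add: num_arr_def)
qed

theorem corollary5p8:
  fixes n :: nat
  assumes "n > 5"
  shows "card (Av n [1,2,3] Adjacent Separated) > card (Av n [1,3,2] Adjacent Separated) \<and>
         card (Av n [1,2,3] Separated Separated) > card (Av n [1,3,2] Separated Separated) \<and>
         card (Av n [1,2,3] Adjacent Adjacent) > card (Av n [1,3,2] Adjacent Adjacent) \<and>
         card (Av n [1,2,3] Separated Adjacent) < card (Av n [1,3,2] Separated Adjacent)"
  using assms adjacent_separated_123_132 separated_separated_123_132 consecutive_123_132
    separated_adjacent_123_132
  by simp

end
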